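(* Let $f$ and $g$ be transcendental entire functions. (i) If $f\circ g=g\circ f$ and $f,g$ are of bounded type, then $\overline{I(f)}=\overline{I(f\circ g)}$. (ii) If $f$ is periodic with period $c\neq0$ and $g=f^m+c$ for some $m\in\mathbb{N}$ (where $f^m$ is the $m$-th iterate), then $\overline{I(f)}=\overline{I(f\circ g)}$.
   Context: For an entire function $f$, $f^n$ denotes the $n$-th iterate and $I(f)=\{z\in\mathbb{C}: f^n(z)\to\infty\}$ is its escaping set; $\overline{E}$ denotes closure in $\mathbb{C}$. A transcendental entire function is of bounded type if the set of its critical values and finite asymptotic values, together with their finite limit points, is bounded. *)

theory Defs
  imports "HOL-Analysis.Analysis" "HOL-Computational_Algebra.Polynomial"
begin

definition transcendental_entire :: "(complex \<Rightarrow> complex) \<Rightarrow> bool" where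
  "transcendental_entire f \<longleftrightarrow> f holomorphic_on UNIV \<and> \<not> (\<exists>p. \<forall>z. f z = poly p z)"

definition escaping_set :: "(complex \<Rightarrow> complex) \<Rightarrow> complex set" where
  "escaping_set f = {z. filterlim (\<lambda>n. (f ^^ n) z) at_infinity sequentially}"

definition critical_values :: "(complex \<Rightarrow> complex) \<Rightarrow> complex set" where
  "critical_values f = {f z | z. deriv f z = 0}"

definition asymptotic_values :: "(complex \<Rightarrow> complex) \<Rightarrow> complex set" where
  "asymptotic_values f = {a. \<exists>\<gamma> :: real \<Rightarrow> complex. continuous_on {0..<1} \<gamma> \<and>
       filterlim \<gamma> at_infinity (at_left 1) \<and> ((\<lambda>t. f (\<gamma> t)) \<longlongrightarrow> a) (at_left 1)}"

definition bounded_type :: "(complex \<Rightarrow> complex) \<Rightarrow> bool" where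
  "bounded_type f \<longleftrightarrow> bounded (closure (critical_values f \<union> asymptotic_values f))"

end

theory Submission
  imports Defs "HOL-Complex_Analysis.Complex_Analysis"
begin

text \<open>
  In part (ii) the composition is the iterate \<open>f\<^sup>m\<^sup>+\<^sup>1\<close>, whose escaping set is that of \<open>f\<close>.

  In part (i) put \<open>h = f \<circ> g\<close>, which is again transcendental of bounded type and commutes with \<open>f\<close>.
  By symmetry it suffices to approximate \<open>z\<close> in \<open>I(f)\<close> by points of \<open>I(h)\<close>. Following Eremenko and Lyubich, the
  branches of \<open>f\<^sup>-\<^sup>1 \<circ> exp\<close> exist on a half-plane. A circle on which \<open>|f|\<close> exceeds the bound \<open>R\<close> for the
  singular values would make such a branch periodic and \<open>f\<close> a polynomial, so the minimum modulus of
  \<open>f\<close> is at most \<open>R\<close> on every circle. Bloch's theorem applied to the logarithm of a branch then shows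
  that \<open>f\<close> expands the metric \<open>|dz|/|z|\<close> wherever \<open>|f|\<close> is large. If the iterates of a disc around an
  escaping point stayed outside \<open>|w| \<le> R\<close>, Bloch's theorem would put a full circle into one of them,
  contradicting the bound on the minimum modulus. Hence the iterates are not normal at \<open>z\<close>, and by Schottky's
  theorem they take one of any two given values near \<open>z\<close>; choose both values in \<open>I(h)\<close>, which is backward
  invariant under \<open>f\<close> because \<open>f\<close> and \<open>h\<close> commute. That \<open>I(h)\<close> is nonempty follows again from
  Schottky's theorem: the small minimum modulus and the large maximum modulus force large annuli to cover
  still larger ones.
\<close>

section \<open>Lifting through an entire function\<close>

text \<open>The coincidence set is closed by continuity and open because \<open>f\<close> is
  injective near a noncritical point. The domain is an arbitrary metric space so that the lemma
  serves discs, half-planes and the parameter interval of a circle alike.\<close>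

lemma lift_unique:
  fixes p q :: "'a::metric_space \<Rightarrow> complex"
  assumes f: "f holomorphic_on UNIV" and S: "connected S"
    and cont: "continuous_on S p" "continuous_on S q"
    and eq: "\<And>x. x \<in> S \<Longrightarrow> f (p x) = f (q x)"
    and nz: "\<And>x. x \<in> S \<Longrightarrow> deriv f (p x) \<noteq> 0"
    and a: "a \<in> S" "p a = q a" and x: "x \<in> S"
  shows "p x = q x"
proof -
  define T where "T = {x \<in> S. p x = q x}"
  have "T = S \<inter> (\<lambda>x. p x - q x) -` {0}"
    by (auto simp: T_def)
  then have cl: "closedin (top_of_set S) T"
    using cont by (auto intro!: continuous_closedin_preimage continuous_intros)
  have "openin (top_of_set S) T"
  proof (subst openin_subopen, intro ballI)
    fix x assume x: "x \<in> T"
    then have xS: "x \<in> S" and pq: "p x = q x" by (auto simp: T_def)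
    obtain r where r: "r > 0" "inj_on f (ball (p x) r)"
      using has_complex_derivative_locally_invertible[OF f, of "p x"] nz[OF xS] by auto
    define U where "U = (S \<inter> p -` ball (p x) r) \<inter> (S \<inter> q -` ball (p x) r)"
    have "openin (top_of_set S) U"
      unfolding U_def using cont
      by (intro openin_Int continuous_openin_preimage_gen) auto
    moreover have "x \<in> U" using xS pq r by (auto simp: U_def)
    moreover have "U \<subseteq> T"
      using r(2) eq by (auto simp: U_def T_def inj_on_def)
    ultimately show "\<exists>U. openin (top_of_set S) U \<and> x \<in> U \<and> U \<subseteq> T" by blast
  qed
  with cl S a have "T = S"
    unfolding connected_clopen T_def by blast
  with x show ?thesis by (auto simp: T_def)
qed

text \<open>The branch is \<open>E\<close> followed by a local inverse of \<open>f\<close> at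
  \<open>z\<close>. The last conclusion says that every solution near \<open>z\<close> is the value
  of this branch; it is what matches the branch with a lift that is already given.\<close>

lemma local_lift:
  assumes f: "f holomorphic_on UNIV" and E: "E holomorphic_on B" and "open B" "x \<in> B"
    and fz: "f z = E x" and nz: "deriv f z \<noteq> 0"
  obtains \<delta> \<epsilon> \<phi> where "\<delta> > 0" "\<epsilon> > 0" "ball x \<delta> \<subseteq> B" "\<phi> holomorphic_on ball x \<delta>"
    "\<And>y. y \<in> ball x \<delta> \<Longrightarrow> f (\<phi> y) = E y"
    "\<And>y u. y \<in> ball x \<delta> \<Longrightarrow> u \<in> ball z \<epsilon> \<Longrightarrow> f u = E y \<Longrightarrow> \<phi> y = u"
proof -
  obtain r where r: "r > 0" "open (f ` ball z r)" "inj_on f (ball z r)"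
    using has_complex_derivative_locally_invertible[OF f, of z] nz by auto
  obtain g where g: "g holomorphic_on f ` ball z r" "\<And>u. u \<in> ball z r \<Longrightarrow> g (f u) = u"
    using holomorphic_has_inverse[OF holomorphic_on_subset[OF f subset_UNIV] open_ball r(3)] by metis
  have "open (B \<inter> E -` (f ` ball z r))"
    using \<open>open B\<close> E r holomorphic_on_imp_continuous_on continuous_open_preimage by blast
  moreover have "x \<in> B \<inter> E -` (f ` ball z r)"
    using \<open>x \<in> B\<close> fz r by auto (metis centre_in_ball imageI)
  ultimately obtain \<delta> where d: "\<delta> > 0" "ball x \<delta> \<subseteq> B \<inter> E -` (f ` ball z r)"
    using open_contains_ball by blast
  show ?thesis
  proof (rule that[of \<delta> r "g \<circ> E"])
    show "g \<circ> E holomorphic_on ball x \<delta>"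
      using d by (intro holomorphic_on_compose_gen[OF holomorphic_on_subset[OF E] g(1)]) auto
    show "f ((g \<circ> E) y) = E y" if "y \<in> ball x \<delta>" for y
      using d that g(2) by fastforce
    show "(g \<circ> E) y = u" if "y \<in> ball x \<delta>" "u \<in> ball z r" "f u = E y" for y u
      using that g(2)[of u] by auto
  qed (use d r in auto)
qed

section \<open>Finite accumulation points of paths\<close>

lemma accumulation_point_of_path:
  fixes p :: "real \<Rightarrow> complex"
  assumes "\<not> filterlim p at_infinity (at_left 1)"
  obtains z where "\<And>\<epsilon>. \<epsilon> > 0 \<Longrightarrow> \<exists>\<^sub>F t in at_left 1. p t \<in> ball z \<epsilon>"
proof -
  obtain K where K: "\<exists>\<^sub>F t in at_left 1. norm (p t) < K"
    using assms by (auto simp: filterlim_at_infinity[OF order_refl] frequently_def not_less)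
  have "\<exists>t. 1 - 1 / real (Suc n) < t \<and> t < 1 \<and> norm (p t) < K" for n
  proof -
    have "\<forall>\<^sub>F t in at_left 1. t \<in> {1 - 1 / real (Suc n)<..<(1::real)}"
      by (rule eventually_at_left_real) auto
    with K have "\<exists>\<^sub>F t in at_left 1. norm (p t) < K \<and> t \<in> {1 - 1 / real (Suc n)<..<(1::real)}"
      by (rule frequently_eventually_frequently)
    then show ?thesis
      by (auto dest!: frequently_ex)
  qed
  then obtain t where t: "\<And>n. 1 - 1 / real (Suc n) < t n" "\<And>n. t n < 1" "\<And>n. norm (p (t n)) < K"
    by metis
  have tl: "t \<longlonglongrightarrow> 1"
  proof (rule tendsto_sandwich[OF _ _ _ tendsto_const])
    show "(\<lambda>n. 1 - 1 / real (Suc n)) \<longlonglongrightarrow> 1"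
      using tendsto_diff[OF tendsto_const[of 1] LIMSEQ_inverse_real_of_nat]
      by (simp add: inverse_eq_divide)
  qed (use t in \<open>auto intro!: always_eventually less_imp_le\<close>)
  then have tf: "filterlim t (at_left 1) sequentially"
    using t by (auto simp: filterlim_at intro!: always_eventually) (metis less_irrefl)
  have "seq_compact (cball (0::complex) K)"
    by (simp add: compact_imp_seq_compact)
  moreover have "\<forall>n. p (t n) \<in> cball 0 K" using t(3) by (auto simp: less_imp_le)
  ultimately obtain z s where s: "strict_mono s" "((\<lambda>n. p (t n)) \<circ> s) \<longlonglongrightarrow> z"
    by (rule seq_compactE)
  show ?thesis
  proof (rule that[of z])
    fix \<epsilon> :: real assume "\<epsilon> > 0"
    then have "\<forall>\<^sub>F n in sequentially. p (t (s n)) \<in> ball z \<epsilon>"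
      using s(2) by (auto simp: tendsto_iff dist_commute o_def)
    then have "\<exists>\<^sub>F n in sequentially. p (t (s n)) \<in> ball z \<epsilon>"
      by (simp add: eventually_frequently)
    moreover have "filterlim (\<lambda>n. t (s n)) (at_left 1) sequentially"
      by (rule filterlim_compose[OF tf filterlim_subseq[OF s(1)]])
    ultimately show "\<exists>\<^sub>F t in at_left 1. p t \<in> ball z \<epsilon>"
      unfolding frequently_def filterlim_iff by blast
  qed
qed

text \<open>By continuity, \<open>f\<close> is close to \<open>f z\<close> at the times when the
  path is near \<open>z\<close>, while at all late times it is close to \<open>w\<close>.\<close>

lemma accumulation_value:
  fixes p :: "real \<Rightarrow> complex"
  assumes z: "\<And>\<epsilon>. \<epsilon> > 0 \<Longrightarrow> \<exists>\<^sub>F t in at_left 1. p t \<in> ball z \<epsilon>"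
    and f: "f holomorphic_on UNIV" and lim: "((\<lambda>t. f (p t)) \<longlongrightarrow> w) (at_left 1)"
  shows "f z = w"
proof (rule ccontr)
  assume ne: "f z \<noteq> w"
  define e where "e = dist (f z) w / 2"
  have e: "e > 0" using ne by (simp add: e_def)
  have "isCont f z" using f using continuous_on_eq_continuous_at holomorphic_on_imp_continuous_on open_UNIV by blast
  then obtain d where d: "d > 0" "\<And>u. dist u z < d \<Longrightarrow> dist (f u) (f z) < e"
    using e unfolding continuous_at_eps_delta by blast
  have "\<forall>\<^sub>F t in at_left 1. dist (f (p t)) w < e" using lim e by (simp add: tendsto_iff)
  with z[OF d(1)] have "\<exists>\<^sub>F t in at_left 1. p t \<in> ball z d \<and> dist (f (p t)) w < e"
    by (rule frequently_eventually_frequently)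
  then obtain t where "p t \<in> ball z d" "dist (f (p t)) w < e" by (auto dest!: frequently_ex)
  then have "dist (f z) w < e + e"
    using d(2)[of "p t"] by (smt (verit) dist_commute dist_triangle2 mem_ball)
  then show False by (simp add: e_def)
qed

text \<open>Along the radius to \<open>y\<close> the lift cannot tend to infinity, since
  \<open>E y\<close> would then be an asymptotic value. So it accumulates at some \<open>z\<close>
  with \<open>f z = E y\<close>, a noncritical point, and the local branch of the inverse at
  \<open>z\<close> continues the lift.\<close>

lemma lift_extends_at_sphere:
  assumes f: "f holomorphic_on UNIV"
    and E: "E holomorphic_on ball c \<rho>"
    and nocrit: "\<And>x. x \<in> ball c \<rho> \<Longrightarrow> E x \<notin> critical_values f"
    and noasym: "\<And>x. x \<in> ball c \<rho> \<Longrightarrow> E x \<notin> asymptotic_values f"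
    and r: "0 < r" "r < \<rho>"
    and \<phi>: "\<phi> holomorphic_on ball c r" "\<And>x. x \<in> ball c r \<Longrightarrow> f (\<phi> x) = E x"
    and y: "y \<in> sphere c r"
  shows "\<exists>\<delta> \<psi>. \<delta> > 0 \<and> ball y \<delta> \<subseteq> ball c \<rho> \<and> \<psi> holomorphic_on ball y \<delta> \<and>
     (\<forall>x \<in> ball y \<delta>. f (\<psi> x) = E x) \<and> (\<forall>x \<in> ball y \<delta> \<inter> ball c r. \<psi> x = \<phi> x)"
proof -
  have yB: "y \<in> ball c \<rho>" using y r by auto
  define \<gamma> where "\<gamma> t = c + of_real t * (y - c)" for t :: real
  define p where "p t = \<phi> (\<gamma> t)" for t
  have dg: "dist c (\<gamma> t) = \<bar>t\<bar> * r" for t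
    using y by (simp add: \<gamma>_def dist_norm norm_mult norm_minus_commute)
  have gin: "\<gamma> t \<in> ball c r" if "t \<in> {0..<1}" for t
    using that dg[of t] r by simp
  have gl: "(\<gamma> \<longlongrightarrow> y) (at_left 1)"
    unfolding \<gamma>_def by (rule tendsto_eq_intros refl | simp)+
  have contE: "isCont E y"
    using E yB continuous_on_eq_continuous_at holomorphic_on_imp_continuous_on open_ball by blast
  have El: "((\<lambda>t. E (\<gamma> t)) \<longlongrightarrow> E y) (at_left 1)"
    using isCont_tendsto_compose[OF contE gl] .
  have evt: "\<forall>\<^sub>F t in at_left 1. t \<in> {0<..<(1::real)}"
    by (rule eventually_at_left_real) auto
  then have "\<forall>\<^sub>F t in at_left 1. E (\<gamma> t) = f (p t)"
    by eventually_elim (use \<phi>(2) gin in \<open>auto simp: p_def\<close>)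
  then have fl: "((\<lambda>t. f (p t)) \<longlongrightarrow> E y) (at_left 1)"
    by (rule Lim_transform_eventually[OF El])
  have "continuous_on {0..<1} p"
    unfolding p_def
  proof (rule continuous_on_compose2[OF holomorphic_on_imp_continuous_on[OF \<phi>(1)]])
    show "continuous_on {0..<1} \<gamma>" unfolding \<gamma>_def by (intro continuous_intros)
  qed (use gin in auto)
  then have "\<not> filterlim p at_infinity (at_left 1)"
    using noasym[OF yB] fl unfolding asymptotic_values_def by blast
  then obtain z where z: "\<And>\<epsilon>. \<epsilon> > 0 \<Longrightarrow> \<exists>\<^sub>F t in at_left 1. p t \<in> ball z \<epsilon>"
    using accumulation_point_of_path by blast
  have fz: "f z = E y" by (rule accumulation_value[OF z f fl])
  then have nz: "deriv f z \<noteq> 0"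
    using nocrit[OF yB] by (auto simp: critical_values_def)
  obtain \<delta> \<epsilon> \<psi> where d: "\<delta> > 0" "\<epsilon> > 0" "ball y \<delta> \<subseteq> ball c \<rho>" "\<psi> holomorphic_on ball y \<delta>"
    "\<And>x. x \<in> ball y \<delta> \<Longrightarrow> f (\<psi> x) = E x"
    "\<And>x u. x \<in> ball y \<delta> \<Longrightarrow> u \<in> ball z \<epsilon> \<Longrightarrow> f u = E x \<Longrightarrow> \<psi> x = u"
    by (rule local_lift[OF f E open_ball yB fz nz]) (rule that)
  have "\<forall>\<^sub>F t in at_left 1. \<gamma> t \<in> ball y \<delta>"
    using gl d(1) by (auto simp: tendsto_iff dist_commute)
  with evt have "\<forall>\<^sub>F t in at_left 1. t \<in> {0<..<1} \<and> \<gamma> t \<in> ball y \<delta>"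
    by (rule eventually_conj)
  with z[OF d(2)] have "\<exists>\<^sub>F t in at_left 1. p t \<in> ball z \<epsilon> \<and> t \<in> {0<..<1} \<and> \<gamma> t \<in> ball y \<delta>"
    by (rule frequently_eventually_frequently)
  then obtain t where t: "p t \<in> ball z \<epsilon>" "t \<in> {0<..<1}" "\<gamma> t \<in> ball y \<delta>"
    by (auto dest!: frequently_ex)
  have tr: "\<gamma> t \<in> ball c r" using gin t by auto
  \<comment> \<open>One common value suffices: the intersection of the two discs is convex, so
    uniqueness of lifts spreads the agreement over all of it.\<close>
  have "\<psi> (\<gamma> t) = \<phi> (\<gamma> t)"
    using d(6)[OF t(3) t(1)] \<phi>(2)[OF tr] by (simp add: p_def)
  then have "\<psi> x = \<phi> x" if "x \<in> ball y \<delta> \<inter> ball c r" for x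
  proof (rule lift_unique[where S = "ball y \<delta> \<inter> ball c r" and f = f, OF f, rotated -2])
    show "connected (ball y \<delta> \<inter> ball c r)" by (intro convex_connected convex_Int convex_ball)
    show "continuous_on (ball y \<delta> \<inter> ball c r) \<psi>" "continuous_on (ball y \<delta> \<inter> ball c r) \<phi>"
      using d(4) \<phi>(1) by (auto intro: holomorphic_on_imp_continuous_on holomorphic_on_subset)
    show "deriv f (\<psi> x) \<noteq> 0" if "x \<in> ball y \<delta> \<inter> ball c r" for x
      using d(3,5) nocrit[of x] that by (force simp: critical_values_def)
  qed (use that t tr d(5) \<phi>(2) in auto)
  with d show ?thesis by blast
qed

text \<open>The point dividing the segment from \<open>x\<close> to \<open>y\<close> in the ratio
  \<open>d : e\<close> lies in both discs and, by convexity, in the closed disc; openness then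
  yields a point of the open disc. This gives two overlapping local extensions a place where both
  equal the original lift.\<close>

lemma balls_on_sphere_meet_inside:
  fixes x y :: complex
  assumes xy: "x \<in> sphere c r" "y \<in> sphere c r" and d: "d > 0" "e > 0" and r: "r > 0"
    and ne: "ball x d \<inter> ball y e \<noteq> {}"
  shows "ball x d \<inter> ball y e \<inter> ball c r \<noteq> {}"
proof -
  define k where "k = d / (d + e)"
  define m where "m = x + k *\<^sub>R (y - x)"
  have de: "d + e > 0" using d by auto
  have k: "0 < k" "k < 1" "1 - k = e / (d + e)" using d by (auto simp: k_def divide_simps)
  have "dist x y < d + e"
  proof -
    obtain w where "w \<in> ball x d" "w \<in> ball y e" using ne by auto
    then show ?thesis using dist_triangle2[of x y w] by (auto simp: dist_commute)
  qed
  then have bd: "d * dist x y / (d + e) < d" "e * dist x y / (d + e) < e"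
    using d de by (simp_all add: divide_less_eq)
  have "dist x m = d * dist x y / (d + e)"
    using d by (simp add: m_def dist_norm norm_minus_commute k_def)
  then have mx: "m \<in> ball x d" using bd by simp
  have "m - y = (1 - k) *\<^sub>R (x - y)" by (simp add: m_def algebra_simps)
  then have "dist y m = \<bar>1 - k\<bar> * dist x y"
    by (metis dist_norm norm_minus_commute norm_scaleR dist_commute)
  then have my: "m \<in> ball y e" using bd k d by simp
  have "m = (1 - k) *\<^sub>R x + k *\<^sub>R y" by (simp add: m_def algebra_simps)
  then have mc: "m \<in> cball c r"
    using convexD[OF convex_cball, of x c r y "1 - k" k] xy k by auto
  have "m \<in> closure (ball c r)" using mc r by simp
  moreover have "open (ball x d \<inter> ball y e)" by auto
  ultimately show ?thesis
    using mx my closure_iff_nhds_not_empty[of m "ball c r"] by blast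
qed

text \<open>Two local extensions agree on their overlap, because it is convex and meets the original
  disc. They therefore glue to a lift on a neighbourhood of the closed disc, and compactness turns
  this neighbourhood into a concentric disc of larger radius.\<close>

lemma lift_extends_to_larger_ball:
  assumes f: "f holomorphic_on UNIV"
    and E: "E holomorphic_on ball c \<rho>"
    and nocrit: "\<And>x. x \<in> ball c \<rho> \<Longrightarrow> E x \<notin> critical_values f"
    and noasym: "\<And>x. x \<in> ball c \<rho> \<Longrightarrow> E x \<notin> asymptotic_values f"
    and r: "0 < r" "r < \<rho>"
    and \<phi>: "\<phi> holomorphic_on ball c r" "\<And>x. x \<in> ball c r \<Longrightarrow> f (\<phi> x) = E x"
  obtains r' \<Psi> where "r < r'" "r' \<le> \<rho>" "\<Psi> holomorphic_on ball c r'"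
    "\<And>x. x \<in> ball c r' \<Longrightarrow> f (\<Psi> x) = E x" "\<And>x. x \<in> ball c r \<Longrightarrow> \<Psi> x = \<phi> x"
proof -
  have "\<forall>y \<in> sphere c r. \<exists>\<delta> \<psi>. \<delta> > 0 \<and> ball y \<delta> \<subseteq> ball c \<rho> \<and> \<psi> holomorphic_on ball y \<delta> \<and>
     (\<forall>x \<in> ball y \<delta>. f (\<psi> x) = E x) \<and> (\<forall>x \<in> ball y \<delta> \<inter> ball c r. \<psi> x = \<phi> x)"
    by (intro ballI lift_extends_at_sphere[OF f E nocrit noasym r \<phi>])
  from bchoice[OF this] obtain \<delta> where \<delta>: "\<forall>y \<in> sphere c r. \<exists>\<psi>. \<delta> y > 0 \<and> ball y (\<delta> y) \<subseteq> ball c \<rho> \<and> \<psi> holomorphic_on ball y (\<delta> y) \<and>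
     (\<forall>x \<in> ball y (\<delta> y). f (\<psi> x) = E x) \<and> (\<forall>x \<in> ball y (\<delta> y) \<inter> ball c r. \<psi> x = \<phi> x)"
    by (elim exE) (rule that)
  from bchoice[OF \<delta>] obtain \<psi> where "\<forall>y \<in> sphere c r. \<delta> y > 0 \<and> ball y (\<delta> y) \<subseteq> ball c \<rho> \<and> \<psi> y holomorphic_on ball y (\<delta> y) \<and>
     (\<forall>x \<in> ball y (\<delta> y). f (\<psi> y x) = E x) \<and> (\<forall>x \<in> ball y (\<delta> y) \<inter> ball c r. \<psi> y x = \<phi> x)"
    by (elim exE) (rule that)
  then have d: "\<And>y. y \<in> sphere c r \<Longrightarrow> \<delta> y > 0"
      "\<And>y. y \<in> sphere c r \<Longrightarrow> ball y (\<delta> y) \<subseteq> ball c \<rho>"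
      "\<And>y. y \<in> sphere c r \<Longrightarrow> \<psi> y holomorphic_on ball y (\<delta> y)"
      "\<And>y x. y \<in> sphere c r \<Longrightarrow> x \<in> ball y (\<delta> y) \<Longrightarrow> f (\<psi> y x) = E x"
      "\<And>y x. y \<in> sphere c r \<Longrightarrow> x \<in> ball y (\<delta> y) \<Longrightarrow> x \<in> ball c r \<Longrightarrow> \<psi> y x = \<phi> x"
    by blast+
  have agree: "\<psi> y x = \<psi> y' x"
    if y: "y \<in> sphere c r" "y' \<in> sphere c r" and x: "x \<in> ball y (\<delta> y) \<inter> ball y' (\<delta> y')" for y y' x
  proof -
    define S where "S = ball y (\<delta> y) \<inter> ball y' (\<delta> y')"
    obtain a where a: "a \<in> S" "a \<in> ball c r"
      using balls_on_sphere_meet_inside[OF y d(1)[OF y(1)] d(1)[OF y(2)] r(1)] x unfolding S_def by blast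
    have nz: "deriv f (\<psi> y u) \<noteq> 0" if "u \<in> S" for u
    proof -
      have u: "u \<in> ball y (\<delta> y)" using that by (simp add: S_def)
      then have "f (\<psi> y u) \<notin> critical_values f"
        using d(2)[OF y(1)] d(4)[OF y(1) u] nocrit[of u] by auto
      then show ?thesis by (auto simp: critical_values_def)
    qed
    have cont: "continuous_on S (\<psi> y)" "continuous_on S (\<psi> y')"
      using d(3) y by (auto simp: S_def intro: holomorphic_on_imp_continuous_on holomorphic_on_subset)
    have "connected S" unfolding S_def by (intro convex_connected convex_Int convex_ball)
    from this cont show ?thesis
    proof (rule lift_unique[OF f, where p = "\<psi> y" and q = "\<psi> y'" and S = S and a = a])
      show "f (\<psi> y u) = f (\<psi> y' u)" if "u \<in> S" for u
        using that d(4) y by (simp add: S_def)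
      show "\<psi> y a = \<psi> y' a" using a y d(5) by (simp add: S_def)
    qed (use a x nz in \<open>auto simp: S_def\<close>)
  qed
  define V where "V = (\<Union>y \<in> sphere c r. ball y (\<delta> y))"
  define \<Psi> where "\<Psi> x = (if x \<in> ball c r then \<phi> x else \<psi> (SOME y. y \<in> sphere c r \<and> x \<in> ball y (\<delta> y)) x)" for x
  have \<Psi>1: "\<Psi> x = \<phi> x" if "x \<in> ball c r" for x using that by (simp add: \<Psi>_def)
  have \<Psi>2: "\<Psi> x = \<psi> y x" if y: "y \<in> sphere c r" and x: "x \<in> ball y (\<delta> y)" for x y
  proof (cases "x \<in> ball c r")
    case True
    then show ?thesis using d(5)[OF y x] by (simp add: \<Psi>_def)
  next
    case False
    define y' where "y' = (SOME y. y \<in> sphere c r \<and> x \<in> ball y (\<delta> y))"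
    have y': "y' \<in> sphere c r \<and> x \<in> ball y' (\<delta> y')"
      unfolding y'_def by (rule someI[of _ y]) (use y x in auto)
    then have "\<psi> y x = \<psi> y' x" using agree[of y y' x] y x by blast
    then show ?thesis using False by (simp add: \<Psi>_def y'_def)
  qed
  have hol: "\<Psi> holomorphic_on ball c r \<union> V"
  proof (rule holomorphic_on_Un)
    show "\<Psi> holomorphic_on ball c r"
      using holomorphic_transform[OF \<phi>(1)] \<Psi>1 by metis
    show "\<Psi> holomorphic_on V"
      unfolding V_def
    proof (rule holomorphic_on_UN_open)
      show "\<Psi> holomorphic_on ball y (\<delta> y)" if "y \<in> sphere c r" for y
        using holomorphic_transform[OF d(3)[OF that]] \<Psi>2[OF that] by metis
    qed auto
  qed (auto simp: V_def)
  have eq: "f (\<Psi> x) = E x" if "x \<in> ball c r \<union> V" for x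
    using that \<Psi>1 \<Psi>2 \<phi>(2) d(4) unfolding V_def by force
  have "cball c r \<subseteq> ball c r \<union> V"
  proof
    fix x assume "x \<in> cball c r"
    then have "x \<in> ball c r \<or> x \<in> sphere c r \<and> x \<in> ball x (\<delta> x)"
      using d(1)[of x] by auto
    then show "x \<in> ball c r \<union> V" unfolding V_def by blast
  qed
  moreover have "open (ball c r \<union> V)" by (auto simp: V_def)
  ultimately obtain e where e: "e > 0" "(\<Union>x\<in>cball c r. ball x e) \<subseteq> ball c r \<union> V"
    using compact_subset_open_imp_ball_epsilon_subset[OF compact_cball] by metis
  define r' where "r' = min \<rho> (r + e)"
  have sub: "ball c r' \<subseteq> ball c r \<union> V"
  proof
    fix x assume x: "x \<in> ball c r'"
    show "x \<in> ball c r \<union> V"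
    proof (cases "x \<in> ball c r")
      case False
      then have n: "norm (x - c) \<ge> r" by (simp add: dist_norm norm_minus_commute)
      \<comment> \<open>The radial projection of \<open>x\<close> to the sphere is at distance less
        than \<open>e\<close> from \<open>x\<close>.\<close>
      define u where "u = c + (r / norm (x - c)) *\<^sub>R (x - c)"
      have "norm (u - c) = r" using n r by (auto simp: u_def)
      then have "u \<in> cball c r" by (simp add: dist_norm norm_minus_commute)
      have "x - u = (1 - r / norm (x - c)) *\<^sub>R (x - c)"
        by (simp add: u_def algebra_simps)
      then have "norm (x - u) = (1 - r / norm (x - c)) * norm (x - c)"
        using n r by (simp add: divide_le_eq_1)
      also have "\<dots> = norm (x - c) - r" using n r by (auto simp: field_simps)
      also have "\<dots> < e" using x by (simp add: r'_def dist_norm norm_minus_commute)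
      finally have "x \<in> ball u e" by (simp add: dist_norm norm_minus_commute)
      with e(2) \<open>u \<in> cball c r\<close> show ?thesis by blast
    qed auto
  qed
  show ?thesis
  proof (rule that[of r' \<Psi>])
    show "\<Psi> holomorphic_on ball c r'" using hol sub holomorphic_on_subset by blast
    show "f (\<Psi> x) = E x" if "x \<in> ball c r'" for x using eq sub that by blast
  qed (use r e \<Psi>1 in \<open>auto simp: r'_def\<close>)
qed

text \<open>Lifts with the prescribed value at the centre are unique, so those on all admissible
  radii fit together on the disc whose radius is the supremum. If that supremum were smaller than
  \<open>\<rho>\<close>, the lift could be extended further.\<close>

lemma lift_on_ball:
  assumes f: "f holomorphic_on UNIV"
    and E: "E holomorphic_on ball c \<rho>" and \<rho>: "\<rho> > 0"
    and nocrit: "\<And>x. x \<in> ball c \<rho> \<Longrightarrow> E x \<notin> critical_values f"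
    and noasym: "\<And>x. x \<in> ball c \<rho> \<Longrightarrow> E x \<notin> asymptotic_values f"
    and z0: "f z0 = E c"
  obtains \<phi> where "\<phi> holomorphic_on ball c \<rho>" "\<And>x. x \<in> ball c \<rho> \<Longrightarrow> f (\<phi> x) = E x" "\<phi> c = z0"
proof -
  define P where "P r \<phi> \<longleftrightarrow> \<phi> holomorphic_on ball c r \<and> (\<forall>x \<in> ball c r. f (\<phi> x) = E x) \<and> \<phi> c = z0" for r \<phi>
  define S where "S = {r. 0 < r \<and> r \<le> \<rho> \<and> (\<exists>\<phi>. P r \<phi>)}"
  have uniq: "\<phi> x = \<phi>' x" if P: "P r \<phi>" "P r' \<phi>'" and r: "r \<in> S" "r' \<in> S"
      and x: "x \<in> ball c r" "x \<in> ball c r'" for r r' \<phi> \<phi>' x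
  proof (rule lift_unique[OF f, where p = \<phi> and q = \<phi>' and S = "ball c (min r r')" and a = c])
    show "continuous_on (ball c (min r r')) \<phi>" "continuous_on (ball c (min r r')) \<phi>'"
      using P by (auto simp: P_def intro!: holomorphic_on_imp_continuous_on elim: holomorphic_on_subset)
    show "deriv f (\<phi> x) \<noteq> 0" if "x \<in> ball c (min r r')" for x
    proof -
      have "f (\<phi> x) \<notin> critical_values f"
        using that P(1) r(1) nocrit[of x] by (auto simp: P_def S_def)
      then show ?thesis by (auto simp: critical_values_def)
    qed
    show "f (\<phi> x) = f (\<phi>' x)" if "x \<in> ball c (min r r')" for x
      using that P by (simp add: P_def)
    show "c \<in> ball c (min r r')" using r by (auto simp: S_def)
    show "\<phi> c = \<phi>' c" using P by (simp add: P_def)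
  qed (use x in auto)
  have cB: "c \<in> ball c \<rho>" using \<rho> by simp
  have nz: "deriv f z0 \<noteq> 0" using nocrit[OF cB] z0 by (auto simp: critical_values_def)
  obtain \<delta> \<epsilon> \<phi>0 where d: "\<delta> > 0" "\<epsilon> > 0" "ball c \<delta> \<subseteq> ball c \<rho>" "\<phi>0 holomorphic_on ball c \<delta>"
    "\<And>x. x \<in> ball c \<delta> \<Longrightarrow> f (\<phi>0 x) = E x"
    "\<And>x u. x \<in> ball c \<delta> \<Longrightarrow> u \<in> ball z0 \<epsilon> \<Longrightarrow> f u = E x \<Longrightarrow> \<phi>0 x = u"
    by (rule local_lift[OF f E open_ball cB z0 nz]) (rule that)
  have "P \<delta> \<phi>0" using d z0 by (simp add: P_def)
  moreover have "\<delta> \<le> \<rho>" using d(1,3) by (simp add: ball_subset_ball_iff)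
  ultimately have "\<delta> \<in> S" using d(1) by (auto simp: S_def)
  define \<sigma> where "\<sigma> = Sup S"
  have bdd: "bdd_above S" by (auto simp: S_def bdd_above_def)
  have \<sigma>: "\<delta> \<le> \<sigma>" "\<sigma> \<le> \<rho>"
    unfolding \<sigma>_def using bdd \<open>\<delta> \<in> S\<close> by (auto intro!: cSup_upper cSup_least simp: S_def)
  have "\<exists>r\<in>S. x \<in> ball c r" if "x \<in> ball c \<sigma>" for x
    using that less_cSupD[of S "dist c x"] \<open>\<delta> \<in> S\<close> by (auto simp: \<sigma>_def)
  then obtain R where R: "\<And>x. x \<in> ball c \<sigma> \<Longrightarrow> R x \<in> S \<and> x \<in> ball c (R x)" by metis
  have "\<forall>r\<in>S. \<exists>\<phi>. P r \<phi>" by (auto simp: S_def)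
  from bchoice[OF this] obtain F where F: "\<And>r. r \<in> S \<Longrightarrow> P r (F r)" by blast
  define \<Phi> where "\<Phi> x = F (R x) x" for x
  have \<Phi>: "\<Phi> x = F r x" if "r \<in> S" "x \<in> ball c r" for r x
  proof -
    have "r \<le> \<sigma>" unfolding \<sigma>_def using bdd that by (auto intro: cSup_upper)
    then have "x \<in> ball c \<sigma>" using that by auto
    then show ?thesis unfolding \<Phi>_def using R that F uniq by blast
  qed
  have UN: "ball c \<sigma> \<subseteq> (\<Union>r\<in>S. ball c r)" using R by blast
  have "\<Phi> holomorphic_on (\<Union>r\<in>S. ball c r)"
  proof (rule holomorphic_on_UN_open)
    show "\<Phi> holomorphic_on ball c r" if "r \<in> S" for r
      using holomorphic_transform[of "F r" "ball c r" \<Phi>] F[OF that] \<Phi>[OF that] by (simp add: P_def)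
  qed auto
  then have hol: "\<Phi> holomorphic_on ball c \<sigma>" using UN holomorphic_on_subset by blast
  have eq: "f (\<Phi> x) = E x" if "x \<in> ball c \<sigma>" for x
    using R[OF that] F \<Phi> by (metis P_def)
  have \<Phi>c: "\<Phi> c = z0"
    using \<Phi>[OF \<open>\<delta> \<in> S\<close>, of c] F[OF \<open>\<delta> \<in> S\<close>] d by (simp add: P_def)
  have "\<sigma> = \<rho>"
  proof (rule ccontr)
    assume "\<sigma> \<noteq> \<rho>"
    then have lt: "\<sigma> < \<rho>" and pos: "0 < \<sigma>" using \<sigma> d(1) by auto
    obtain r' \<Psi> where r': "\<sigma> < r'" "r' \<le> \<rho>" "\<Psi> holomorphic_on ball c r'"
      "\<And>x. x \<in> ball c r' \<Longrightarrow> f (\<Psi> x) = E x" "\<And>x. x \<in> ball c \<sigma> \<Longrightarrow> \<Psi> x = \<Phi> x"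
      by (rule lift_extends_to_larger_ball[OF f E nocrit noasym pos lt hol eq]) (auto intro: that)
    have "\<Psi> c = z0" using r'(5)[of c] pos \<Phi>c by simp
    then have "P r' \<Psi>" using r' by (simp add: P_def)
    then have "r' \<in> S" using r' pos by (auto simp: S_def)
    then have "r' \<le> \<sigma>" unfolding \<sigma>_def using bdd by (auto intro: cSup_upper)
    with r' show False by simp
  qed
  then show ?thesis using that hol eq \<Phi>c by blast
qed

section \<open>Minimum modulus for bounded singular values\<close>

text \<open>A proper entire function is a polynomial.\<close>

lemma transcendental_entire_not_proper:
  assumes "transcendental_entire f"
  shows "\<not> (\<forall>K. compact K \<longrightarrow> compact {z. f z \<in> K})"
proof
  assume "\<forall>K. compact K \<longrightarrow> compact {z. f z \<in> K}"
  then obtain c n where "f = (\<lambda>z. \<Sum>i\<le>n. c i * z ^ i)"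
    using assms proper_map_polyfun_eq[of f] unfolding transcendental_entire_def by blast
  then have "\<forall>z. f z = poly (\<Sum>i\<le>n. monom (c i) i) z"
    by (simp add: poly_sum poly_monom)
  then show False
    using assms unfolding transcendental_entire_def by blast
qed

section \<open>Lifting the exponential from a half-plane\<close>

lemma less_norm_exp_iff:
  fixes w :: complex
  assumes "R > 0"
  shows "R < norm (exp w) \<longleftrightarrow> ln R < Re w"
  using assms by (simp add: norm_exp_eq_Re) (metis exp_less_cancel_iff exp_ln)

text \<open>This is what makes the Cayley transform \<open>(v - 1) / (v + 1)\<close> map the right
  half-plane into the unit disc.\<close>

lemma Re_pos_iff_norm_less: "0 < Re v \<longleftrightarrow> norm (v - 1) < norm (v + 1)"
proof -
  have "norm (v - 1) < norm (v + 1) \<longleftrightarrow> (norm (v - 1))\<^sup>2 < (norm (v + 1))\<^sup>2"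
    using power_strict_mono[of "norm (v - 1)" "norm (v + 1)" 2] power2_less_imp_less[of "norm (v - 1)" "norm (v + 1)"] by auto
  also have "\<dots> \<longleftrightarrow> 0 < Re v"
    unfolding cmod_power2 by (simp add: power2_eq_square algebra_simps)
  finally show ?thesis by simp
qed

text \<open>On the half-plane \<open>exp\<close> takes only values of modulus greater than
  \<open>R\<close>, none of them singular. A Cayley transform carries the half-plane to the unit
  disc, where lifts exist.\<close>

lemma lift_exp_on_halfplane:
  assumes f: "f holomorphic_on UNIV"
    and crit: "critical_values f \<subseteq> cball 0 R" and asym: "asymptotic_values f \<subseteq> cball 0 R"
    and R: "R > 0" and w0: "ln R < Re w0" and z0: "f z0 = exp w0"
  obtains \<phi> where "\<phi> holomorphic_on {w. ln R < Re w}" "\<And>w. ln R < Re w \<Longrightarrow> f (\<phi> w) = exp w" "\<phi> w0 = z0"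
proof -
  define d where "d = Re w0 - ln R"
  define a where "a = w0 - of_real d"
  \<comment> \<open>\<open>\<mu>\<close> sends the unit disc into the half-plane and 0 to
    \<open>w0\<close>; \<open>\<nu>\<close> is its inverse. The point \<open>a\<close> is the
    projection of \<open>w0\<close> to the boundary line.\<close>
  define \<mu> where "\<mu> u = a + of_real d * ((1 + u) / (1 - u))" for u :: complex
  define \<nu> where "\<nu> w = ((w - a) / of_real d - 1) / ((w - a) / of_real d + 1)" for w
  have d: "d > 0" using w0 by (simp add: d_def)
  have Rea: "Re a = ln R" by (simp add: a_def d_def)
  have \<mu>in: "ln R < Re (\<mu> u)" if "u \<in> ball 0 1" for u
  proof -
    have u: "norm u < 1" "1 - u \<noteq> 0" using that by auto
    define v where "v = (1 + u) / (1 - u)"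
    have "v - 1 = u * (v + 1)" "v + 1 \<noteq> 0" using u by (auto simp: v_def field_simps)
    then have "norm (v - 1) < norm (v + 1)" using u by (simp add: norm_mult)
    then have "Re v > 0" by (simp add: Re_pos_iff_norm_less)
    then show ?thesis using d Rea by (simp add: \<mu>_def v_def[symmetric])
  qed
  have \<nu>: "\<nu> w \<in> ball 0 1 \<and> \<mu> (\<nu> w) = w \<and> (w - a) / of_real d + 1 \<noteq> 0" if "ln R < Re w" for w
  proof -
    define v where "v = (w - a) / of_real d"
    have v: "0 < Re v" using that d Rea by (simp add: v_def)
    then have lt: "norm (v - 1) < norm (v + 1)" by (simp add: Re_pos_iff_norm_less)
    then have ne: "v + 1 \<noteq> 0" by auto
    have n: "\<nu> w = (v - 1) / (v + 1)" by (simp add: \<nu>_def v_def)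
    have "1 + \<nu> w = 2 * v / (v + 1)" "1 - \<nu> w = 2 / (v + 1)" unfolding n using ne by (auto simp: field_simps)
    then have "(1 + \<nu> w) / (1 - \<nu> w) = v" using ne by simp
    then have "\<mu> (\<nu> w) = w" using d by (simp add: \<mu>_def v_def)
    moreover have "norm (\<nu> w) < 1" using lt ne by (simp add: n norm_divide)
    ultimately show ?thesis using ne by (simp add: v_def)
  qed
  have big: "norm (exp (\<mu> u)) > R" if "u \<in> ball 0 1" for u
    using \<mu>in[OF that] R by (simp only: less_norm_exp_iff)
  have holE: "(\<lambda>u. exp (\<mu> u)) holomorphic_on ball 0 1"
    unfolding \<mu>_def by (intro holomorphic_intros) auto
  have nocrit: "exp (\<mu> u) \<notin> critical_values f" "exp (\<mu> u) \<notin> asymptotic_values f" if "u \<in> ball 0 1" for u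
    using big[OF that] crit asym by auto
  have "f z0 = exp (\<mu> 0)" using z0 by (simp add: \<mu>_def a_def)
  then obtain \<phi> where \<phi>: "\<phi> holomorphic_on ball 0 1" "\<And>u. u \<in> ball 0 1 \<Longrightarrow> f (\<phi> u) = exp (\<mu> u)" "\<phi> 0 = z0"
    using lift_on_ball[OF f holE zero_less_one nocrit] by metis
  show ?thesis
  proof (rule that[of "\<phi> \<circ> \<nu>"])
    have "\<nu> holomorphic_on {w. ln R < Re w}"
      unfolding \<nu>_def using \<nu> d by (intro holomorphic_intros) auto
    then show "\<phi> \<circ> \<nu> holomorphic_on {w. ln R < Re w}"
      by (rule holomorphic_on_compose_gen[OF _ \<phi>(1)]) (use \<nu> in auto)
    show "f ((\<phi> \<circ> \<nu>) w) = exp w" if "ln R < Re w" for w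
      using \<nu>[OF that] \<phi>(2) by auto
    have "\<nu> w0 = 0" using d by (simp add: \<nu>_def a_def)
    then show "(\<phi> \<circ> \<nu>) w0 = z0" using \<phi>(3) by simp
  qed
qed

lemma periodic_on_halfplane_int:
  fixes \<phi> :: "complex \<Rightarrow> 'a"
  assumes per: "\<And>w. a < Re w \<Longrightarrow> \<phi> (w + T) = \<phi> w" and T: "Re T = 0" and w: "a < Re w"
  shows "\<phi> (w + of_int m * T) = \<phi> w"
proof (induction m rule: int_induct[where k = 0])
  case (step1 i)
  have "\<phi> (w + of_int i * T + T) = \<phi> (w + of_int i * T)" by (rule per) (use w T in simp)
  then show ?case using step1 by (simp add: algebra_simps)
next
  case (step2 i)
  have "\<phi> (w + of_int (i - 1) * T + T) = \<phi> (w + of_int (i - 1) * T)" by (rule per) (use w T in simp)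
  then show ?case using step2 by (simp add: algebra_simps)
qed simp

text \<open>A lift of the exponential through \<open>f\<close> that is periodic descends to a punctured disc around \<open>\<infinity>\<close>, where
  its only possible singularity is a pole; hence \<open>f\<close> tends to \<open>\<infinity>\<close> and is a polynomial.\<close>

lemma no_periodic_lift_of_exp:
  assumes te: "transcendental_entire f"
    and \<phi>: "\<phi> holomorphic_on {w. ln R < Re w}" "\<And>w. ln R < Re w \<Longrightarrow> f (\<phi> w) = exp w"
    and nz: "\<And>w. ln R < Re w \<Longrightarrow> \<phi> w \<noteq> 0"
    and per: "\<And>w. ln R < Re w \<Longrightarrow> \<phi> (w + of_int (2 * n) * of_real pi * \<i>) = \<phi> w"
    and n: "n \<noteq> 0"
  shows False
proof -
  have f: "f holomorphic_on UNIV" using te by (simp add: transcendental_entire_def)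
  then have contf: "continuous_on A f" for A
    by (meson holomorphic_on_imp_continuous_on holomorphic_on_subset subset_UNIV)
  define M :: real where "M = of_int \<bar>n\<bar>"
  have M: "M > 0" using n by (simp add: M_def)
  have Mn: "complex_of_real M = of_int (sgn n) * of_int n"
    by (simp add: M_def abs_sgn[of n])
  have perM: "\<phi> (w + of_real M * (of_int (2 * k) * of_real pi * \<i>)) = \<phi> w" if "ln R < Re w" for w k
  proof -
    have "of_real M * (of_int (2 * k) * of_real pi * \<i>) = of_int (k * sgn n) * (of_int (2 * n) * of_real pi * \<i>)"
      by (simp add: Mn algebra_simps)
    then show ?thesis
      using periodic_on_halfplane_int[where \<phi> = \<phi> and T = "of_int (2 * n) * of_real pi * \<i>" and m = "k * sgn n", OF per _ that] by (simp only:) simp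
  qed
  \<comment> \<open>With this radius, \<open>norm q < \<rho>\<close> means exactly that
    \<open>- M * Ln q\<close> lies in the half-plane, for \<open>q\<close> other than 0.\<close>
  define \<rho> where "\<rho> = exp (- ln R / M)"
  have \<rho>: "\<rho> > 0" by (simp add: \<rho>_def)
  have small: "B < Re (- of_real M * w)" if "Re w < - B / M" for w B
    using that M by (simp add: field_simps)
  have lnq: "Re (Ln q) = ln (norm q)" "ln (norm q) < x \<longleftrightarrow> norm q < exp x" if "q \<noteq> 0" for q x
    using that by simp (metis exp_less_cancel_iff exp_ln that zero_less_norm_iff)
  have inH: "ln R < Re (- of_real M * Ln q)" if "q \<in> ball 0 \<rho>" "q \<noteq> 0" for q
    using that small[of "Ln q" "ln R"] lnq(1)[of q] lnq(2)[of q "- ln R / M"] by (simp add: \<rho>_def)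
  define \<Phi> where "\<Phi> q = \<phi> (- of_real M * Ln q)" for q
  \<comment> \<open>\<open>Ln\<close> jumps on the negative axis. Near \<open>q0\<close> it is
    replaced by \<open>Ln (q / q0) + Ln q0\<close>, which is holomorphic there and differs from
    \<open>Ln q\<close> by a multiple of \<open>2 * pi * \<i>\<close>; the factor \<open>M\<close>
    turns this into a multiple of the period of \<open>\<phi>\<close>.\<close>
  have "\<exists>U. open U \<and> q0 \<in> U \<and> U \<subseteq> ball 0 \<rho> - {0} \<and> \<Phi> holomorphic_on U" if q0: "q0 \<in> ball 0 \<rho> - {0}" for q0
  proof -
    define U where "U = {q. q / q0 \<in> - \<real>\<^sub>\<le>\<^sub>0} \<inter> (ball 0 \<rho> - {0})"
    have q0nz: "q0 \<noteq> 0" using q0 by auto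
    have "open {q. q / q0 \<in> - \<real>\<^sub>\<le>\<^sub>0}"
      using open_vimage[of "- \<real>\<^sub>\<le>\<^sub>0" "\<lambda>q. q / q0"] closed_nonpos_Reals_complex
      by (simp add: vimage_def open_Compl q0nz continuous_intros)
    then have "open U" by (simp add: U_def open_Int open_delete)
    moreover have "q0 \<in> U" using q0 q0nz by (simp add: U_def)
    moreover have "\<Phi> holomorphic_on U"
    proof -
      have shift: "\<exists>k. Ln q = (Ln (q / q0) + Ln q0) + of_int (2 * k) * of_real pi * \<i>" if "q \<in> U" for q
      proof -
        have "exp (Ln q) = exp (Ln (q / q0) + Ln q0)"
          using that q0nz by (auto simp: U_def exp_add)
        then show ?thesis unfolding exp_eq by (simp add: algebra_simps)
      qed
      define L where "L q = - of_real M * (Ln (q / q0) + Ln q0)" for q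
      have L: "ln R < Re (L q)" "\<phi> (L q) = \<Phi> q" if q: "q \<in> U" for q
      proof -
        obtain k where k: "Ln q = (Ln (q / q0) + Ln q0) + of_int (2 * k) * of_real pi * \<i>"
          using shift[OF q] by blast
        then have Lq: "- of_real M * Ln q = L q + of_real M * (of_int (2 * (- k)) * of_real pi * \<i>)"
          by (simp add: L_def algebra_simps)
        have "ln R < Re (- of_real M * Ln q)" using q by (intro inH) (auto simp: U_def)
        then show l: "ln R < Re (L q)" by (subst (asm) Lq) simp
        show "\<phi> (L q) = \<Phi> q" unfolding \<Phi>_def Lq by (rule perM[OF l, symmetric])
      qed
      have "L holomorphic_on U"
        unfolding L_def using q0nz by (intro holomorphic_intros) (auto simp: U_def)
      then have "\<phi> \<circ> L holomorphic_on U"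
        by (rule holomorphic_on_compose_gen[OF _ \<phi>(1)]) (use L in auto)
      then show ?thesis by (rule holomorphic_transform) (use L in auto)
    qed
    ultimately show ?thesis unfolding U_def by blast
  qed
  then have "\<exists>f'. (\<Phi> has_field_derivative f') (at q)" if "q \<in> ball 0 \<rho> - {0}" for q
    using that holomorphic_on_open by blast
  then have hol\<Phi>: "\<Phi> holomorphic_on ball 0 \<rho> - {0}"
    by (subst holomorphic_on_open) (auto intro: open_delete)
  have \<Phi>nz: "\<Phi> q \<noteq> 0" if "q \<in> ball 0 \<rho> - {0}" for q
    unfolding \<Phi>_def using that inH nz by blast
  have large: "norm (f (\<Phi> q)) > B" if q: "q \<in> ball 0 \<rho> - {0}" and B: "B > 0" "norm q < exp (- ln B / M)" for q B
  proof -
    have "f (\<Phi> q) = exp (- of_real M * Ln q)" unfolding \<Phi>_def using q inH \<phi>(2) by blast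
    moreover have "ln B < Re (- of_real M * Ln q)"
      using q B lnq(1)[of q] lnq(2)[of q "- ln B / M"] by (intro small) auto
    ultimately show ?thesis using B by (simp only: less_norm_exp_iff)
  qed
  \<comment> \<open>\<open>f\<close> is bounded on discs, whereas \<open>f (\<Phi> q)\<close> tends
    to infinity as \<open>q\<close> tends to 0; so \<open>\<Phi> q\<close> leaves every
    disc.\<close>
  have lim: "((\<lambda>q. inverse (\<Phi> q)) \<longlongrightarrow> 0) (at 0)"
  proof (rule tendstoI)
    fix e :: real assume e: "e > 0"
    have "bounded (f ` cball 0 (1 / e))"
      using contf by (intro compact_imp_bounded compact_continuous_image) auto
    then obtain B where B: "B > 0" "\<And>z. z \<in> cball 0 (1 / e) \<Longrightarrow> norm (f z) \<le> B"
      unfolding bounded_pos by auto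
    have "\<forall>\<^sub>F q in at 0. q \<in> ball 0 (min \<rho> (exp (- ln B / M))) - {0}"
      using \<rho> by (intro eventually_at_in_open) auto
    then show "\<forall>\<^sub>F q in at 0. dist (inverse (\<Phi> q)) 0 < e"
    proof eventually_elim
      case (elim q)
      then have "norm (f (\<Phi> q)) > B" using large B by auto
      then have "norm (\<Phi> q) > 1 / e" using B(2)[of "\<Phi> q"] by force
      then have "inverse (norm (\<Phi> q)) < inverse (1 / e)" using e by (intro less_imp_inverse_less) auto
      then show ?case by (simp add: norm_inverse)
    qed
  qed
  define \<chi>' where "\<chi>' q = (if q = 0 then 0 else inverse (\<Phi> q))" for q
  have hol: "\<chi>' holomorphic_on ball 0 \<rho>"
    unfolding \<chi>'_def
    by (rule removable_singularity) (use lim hol\<Phi> \<Phi>nz in \<open>auto intro!: holomorphic_intros\<close>)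
  have nonconst: "\<not> \<chi>' constant_on ball 0 \<rho>"
  proof
    assume "\<chi>' constant_on ball 0 \<rho>"
    moreover have "0 \<in> ball 0 \<rho>" "of_real (\<rho> / 2) \<in> ball (0::complex) \<rho>" using \<rho> by auto
    ultimately have "\<chi>' (of_real (\<rho> / 2)) = \<chi>' 0" unfolding constant_on_def by metis
    then show False using \<Phi>nz[of "of_real (\<rho> / 2)"] \<rho> by (simp add: \<chi>'_def)
  qed
  have "compact {z. f z \<in> K}" if K: "compact K" for K
  proof -
    obtain B where B: "B > 0" "\<And>w. w \<in> K \<Longrightarrow> norm w \<le> B"
      using compact_imp_bounded[OF K] unfolding bounded_pos by auto
    define \<delta> where "\<delta> = min \<rho> (exp (- ln B / M))"
    \<comment> \<open>By openness at 0, every \<open>z\<close> of large modulus is some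
      \<open>\<Phi> q\<close> with \<open>norm q < \<delta>\<close>, and \<open>f\<close> exceeds
      \<open>B\<close> in modulus there. Hence the preimage of \<open>K\<close> is bounded, so
      \<open>f\<close> would be proper.\<close>
    have "open (\<chi>' ` ball 0 \<delta>)"
      by (rule open_mapping_thm[OF hol _ _ _ _ nonconst]) (auto simp: \<delta>_def)
    moreover have "0 \<in> \<chi>' ` ball 0 \<delta>"
      by (rule image_eqI[of _ _ 0]) (use \<rho> in \<open>auto simp: \<chi>'_def \<delta>_def\<close>)
    ultimately obtain e where e: "e > 0" "ball 0 e \<subseteq> \<chi>' ` ball 0 \<delta>"
      using open_contains_ball by blast
    have "norm z \<le> 1 / e" if "f z \<in> K" for z
    proof (rule ccontr)
      assume "\<not> norm z \<le> 1 / e"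
      then have z: "1 / e < norm z" by simp
      then have znz: "z \<noteq> 0" using e by auto
      have "inverse (norm z) < inverse (1 / e)" using z e by (intro less_imp_inverse_less) auto
      then have "inverse z \<in> ball 0 e" by (simp add: norm_inverse)
      then obtain q where q: "q \<in> ball 0 \<delta>" "\<chi>' q = inverse z" using e by (metis imageE subsetD)
      then have "q \<noteq> 0" using znz by (auto simp: \<chi>'_def)
      then have "\<Phi> q = z" using q by (simp add: \<chi>'_def)
      moreover have "norm (f (\<Phi> q)) > B"
        using q \<open>q \<noteq> 0\<close> B by (intro large) (auto simp: \<delta>_def)
      ultimately show False using B(2)[OF that] by simp
    qed
    then have "bounded {z. f z \<in> K}" unfolding bounded_iff by blast
    moreover have "closed {z. f z \<in> K}"
      using continuous_closed_vimage[of K f] compact_imp_closed[OF K] contf[of UNIV]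
      by (simp add: vimage_def continuous_on_eq_continuous_at)
    ultimately show ?thesis by (simp add: compact_eq_bounded_closed)
  qed
  then show False using transcendental_entire_not_proper[OF te] by blast
qed

text \<open>The condition on \<open>f 0\<close> ensures that the branches of the inverse of
  \<open>f\<close> over \<open>norm w > R\<close> omit 0 and so have holomorphic logarithms on
  simply connected domains.\<close>

locale singular_values_bound =
  fixes f :: "complex \<Rightarrow> complex" and R :: real
  assumes te: "transcendental_entire f"
    and crit: "critical_values f \<subseteq> cball 0 R" and asym: "asymptotic_values f \<subseteq> cball 0 R"
    and f0: "norm (f 0) \<le> R" and R: "R > 0"
begin

lemma holf: "f holomorphic_on UNIV"
  using te by (simp add: transcendental_entire_def)

text \<open>Otherwise \<open>f\<close> along the circle has a logarithm \<open>F\<close> in the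
  half-plane, and the lift \<open>\<phi>\<close> through \<open>F 0\<close> maps the curve
  \<open>F\<close> back to the circle. Since the circle winds once around 0, \<open>F\<close> does
  not close up; its endpoints differ by a nonzero period of \<open>exp\<close>, which is then a
  period of \<open>\<phi>\<close>.\<close>

lemma bounded_minimum_modulus:
  assumes s: "s > 0"
  shows "\<exists>z. norm z = s \<and> norm (f z) \<le> R"
proof (rule ccontr)
  assume "\<not> ?thesis"
  then have big: "R < norm (f z)" if "norm z = s" for z using that by force
  have contf: "continuous_on A f" for A
    using holf by (meson holomorphic_on_imp_continuous_on holomorphic_on_subset subset_UNIV)
  define H where "H = {w. ln R < Re w}"
  have H: "w \<in> H \<longleftrightarrow> R < norm (exp w)" for w
    unfolding H_def less_norm_exp_iff[OF R] by simp
  have Hconv: "convex H" unfolding H_def by (rule convex_halfspace_Re_gt)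
  define \<gamma> where "\<gamma> \<theta> = of_real s * exp (\<i> * of_real \<theta>)" for \<theta> :: real
  have n\<gamma>: "norm (\<gamma> \<theta>) = s" for \<theta> using s by (simp add: \<gamma>_def norm_mult)
  have cont\<gamma>: "continuous_on A \<gamma>" for A unfolding \<gamma>_def by (intro continuous_intros)
  define I where "I = {0..2 * pi}"
  have I: "0 \<in> I" "2 * pi \<in> I" "connected I" by (auto simp: I_def)
  have "continuous_on I (\<lambda>\<theta>. f (\<gamma> \<theta>))"
    by (rule continuous_on_compose2[OF contf cont\<gamma>]) auto
  moreover have "contractible I" unfolding I_def by (intro convex_imp_contractible) auto
  moreover have "f (\<gamma> \<theta>) \<noteq> 0" for \<theta> using big[OF n\<gamma>[of \<theta>]] R by force
  ultimately obtain F where F: "continuous_on I F" "\<And>\<theta>. \<theta> \<in> I \<Longrightarrow> f (\<gamma> \<theta>) = exp (F \<theta>)"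
    using continuous_logarithm_on_contractible by metis
  have FH: "F \<theta> \<in> H" if "\<theta> \<in> I" for \<theta>
    unfolding H using F(2)[OF that] big[OF n\<gamma>[of \<theta>]] by simp
  obtain \<phi> where \<phi>: "\<phi> holomorphic_on H" "\<And>w. w \<in> H \<Longrightarrow> f (\<phi> w) = exp w" "\<phi> (F 0) = \<gamma> 0"
    using lift_exp_on_halfplane[OF holf crit asym R, of "F 0" "\<gamma> 0"] FH[OF I(1)] F(2)[OF I(1)]
    unfolding H_def by auto
  have cont\<phi>: "continuous_on H \<phi>" using \<phi>(1) by (rule holomorphic_on_imp_continuous_on)
  have reg: "deriv f z \<noteq> 0" if "norm (f z) > R" for z
    using crit that by (force simp: critical_values_def)
  have \<phi>F: "\<phi> (F \<theta>) = \<gamma> \<theta>" if "\<theta> \<in> I" for \<theta>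
  proof (rule lift_unique[OF holf I(3), where p = "\<lambda>\<theta>. \<phi> (F \<theta>)" and q = \<gamma> and a = 0])
    show "continuous_on I (\<lambda>\<theta>. \<phi> (F \<theta>))"
      by (rule continuous_on_compose2[OF cont\<phi> F(1)]) (use FH in auto)
    show "deriv f (\<phi> (F \<theta>)) \<noteq> 0" if "\<theta> \<in> I" for \<theta>
      using FH[OF that] \<phi>(2)[OF FH[OF that]] by (intro reg) (simp add: H)
  qed (use that I \<phi> FH F cont\<gamma> in auto)
  have \<phi>nz: "\<phi> w \<noteq> 0" if "w \<in> H" for w
  proof
    assume "\<phi> w = 0"
    then have "norm (exp w) \<le> R" using \<phi>(2)[OF that] f0 by simp
    then show False using that by (simp add: H)
  qed
  obtain \<psi> where \<psi>: "\<psi> holomorphic_on H" "\<And>w. w \<in> H \<Longrightarrow> \<phi> w = exp (\<psi> w)"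
    using contractible_imp_holomorphic_log[OF \<phi>(1) convex_imp_contractible[OF Hconv] \<phi>nz] by metis
  \<comment> \<open>The logarithm of the circle gains \<open>2 * pi * \<i>\<close> in one turn, by
    uniqueness of lifts through \<open>exp\<close>.\<close>
  have "\<psi> (F (2 * pi)) = \<psi> (F 0) + \<i> * of_real (2 * pi)"
  proof (rule lift_unique[OF _ I(3), where f = exp and p = "\<lambda>\<theta>. \<psi> (F \<theta>)" and q = "\<lambda>\<theta>. \<psi> (F 0) + \<i> * of_real \<theta>" and a = 0])
    show "continuous_on I (\<lambda>\<theta>. \<psi> (F \<theta>))"
      by (rule continuous_on_compose2[OF holomorphic_on_imp_continuous_on[OF \<psi>(1)] F(1)]) (use FH in auto)
    show "continuous_on I (\<lambda>\<theta>. \<psi> (F 0) + \<i> * of_real \<theta>)" by (intro continuous_intros)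
    show "exp (\<psi> (F \<theta>)) = exp (\<psi> (F 0) + \<i> * of_real \<theta>)" if "\<theta> \<in> I" for \<theta>
      using \<psi>(2)[OF FH[OF that]] \<psi>(2)[OF FH[OF I(1)]] \<phi>F[OF that] \<phi>F[OF I(1)]
      by (simp add: exp_add \<gamma>_def)
  qed (use I in \<open>auto intro: holomorphic_intros simp: DERIV_imp_deriv[OF DERIV_exp]\<close>)
  then have Fne: "F (2 * pi) \<noteq> F 0" by auto
  have \<gamma>2: "\<gamma> (2 * pi) = \<gamma> 0" by (simp add: \<gamma>_def mult.commute[of \<i>]) 
  then have "exp (F (2 * pi)) = exp (F 0)" using F(2) I by metis
  then obtain n :: int where n: "F (2 * pi) = F 0 + of_int (2 * n) * of_real pi * \<i>"
    unfolding exp_eq by (auto simp: algebra_simps)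
  with Fne have nn: "n \<noteq> 0" by auto
  define T where "T = of_int (2 * n) * of_real pi * \<i>"
  have expT: "exp (w + T) = exp w" for w
    unfolding T_def exp_eq by (intro exI[of _ n]) simp
  have HT: "w + T \<in> H \<longleftrightarrow> w \<in> H" for w by (simp add: H expT)
  have "\<phi> (w + T) = \<phi> w" if "w \<in> H" for w
  proof (rule lift_unique[OF holf convex_connected[OF Hconv], where p = "\<lambda>w. \<phi> (w + T)" and q = \<phi> and a = "F 0"])
    show "continuous_on H (\<lambda>w. \<phi> (w + T))"
      by (rule continuous_on_compose2[OF cont\<phi>]) (auto intro!: continuous_intros simp: HT)
    show "deriv f (\<phi> (w + T)) \<noteq> 0" if "w \<in> H" for w
      using that HT[of w] \<phi>(2)[of "w + T"] by (intro reg) (simp add: H)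
    show "\<phi> (F 0 + T) = \<phi> (F 0)"
      using \<phi>F[OF I(1)] \<phi>F[OF I(2)] \<gamma>2 n by (simp add: T_def)
  qed (use that \<phi>(2) HT expT FH[OF I(1)] cont\<phi> in auto)
  then show False
    using no_periodic_lift_of_exp[OF te \<phi>(1)[unfolded H_def], of n] \<phi>(2) \<phi>nz nn unfolding H_def T_def by blast
qed

end

section \<open>Expansion and escaping orbits\<close>

lemma norm_Ln_le_pi:
  assumes "norm q = 1"
  shows "norm (Ln q) \<le> pi"
proof -
  have q0: "q \<noteq> 0" using assms by auto
  then have "Re (Ln q) = 0" using assms by simp
  moreover have "\<bar>Im (Ln q)\<bar> \<le> pi" using Im_Ln_le_pi[OF q0] mpi_less_Im_Ln[OF q0] by linarith
  ultimately show ?thesis using cmod_le[of "Ln q"] by simp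
qed

text \<open>Each point of the circle of radius \<open>exp (Re b)\<close> has a logarithm within
  distance \<open>pi\<close> of \<open>b\<close>. In this way a large disc provided by Bloch's
  theorem becomes a full circle, to which the bound on the minimum modulus applies.\<close>

lemma exp_image_contains_circle:
  fixes b :: complex
  assumes "ball b r \<subseteq> S" "r > pi"
  shows "\<exists>s>0. sphere 0 s \<subseteq> exp ` S"
proof (intro exI conjI)
  show "exp (Re b) > 0" by simp
  show "sphere 0 (exp (Re b)) \<subseteq> exp ` S"
  proof
    fix z :: complex assume z: "z \<in> sphere 0 (exp (Re b))"
    define q where "q = z / exp b"
    have nq: "norm q = 1" using z by (simp add: q_def norm_divide)
    then have q0: "q \<noteq> 0" by auto
    have "norm (Ln q) \<le> pi" using nq by (rule norm_Ln_le_pi)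
    then have "b + Ln q \<in> S" using assms by (auto simp: dist_norm subset_eq)
    moreover have "exp (b + Ln q) = z" using q0 by (simp add: exp_add) (simp add: q_def)
    ultimately show "z \<in> exp ` S" by blast
  qed
qed

section \<open>Iterates of entire functions\<close>

lemma funpow_holomorphic_on_UNIV:
  assumes "f holomorphic_on UNIV"
  shows "(f ^^ n) holomorphic_on UNIV"
proof (induction n)
  case 0
  show ?case by (simp add: id_def)
next
  case (Suc n)
  then show ?case
    using holomorphic_on_compose_gen[OF Suc assms] by (simp add: o_def)
qed

lemma continuous_on_funpow:
  fixes f :: "'a::topological_space \<Rightarrow> 'a"
  assumes "continuous_on UNIV f"
  shows "continuous_on UNIV (f ^^ n)"
proof (induction n)
  case (Suc n)
  then show ?case
    using continuous_on_compose[OF Suc continuous_on_subset[OF assms subset_UNIV]] by simp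
qed (simp add: id_def)

lemma transcendental_entire_not_constant:
  assumes "transcendental_entire f"
  shows "\<not> f constant_on UNIV"
proof
  assume "f constant_on UNIV"
  then obtain c where "\<forall>z. f z = poly [:c:] z" unfolding constant_on_def by auto
  then show False using assms unfolding transcendental_entire_def by blast
qed

lemma open_funpow_image:
  assumes te: "transcendental_entire f" and D: "open D"
  shows "open ((f ^^ n) ` D)"
proof (induction n)
  case 0
  show ?case using D by simp
next
  case (Suc n)
  have "open (f ` ((f ^^ n) ` D))"
    using Suc te transcendental_entire_not_constant[OF te]
    by (intro open_mapping_thm[of f UNIV]) (auto simp: transcendental_entire_def)
  then show ?case by (simp add: image_comp)
qed

section \<open>Expansion of the metric \<open>|dz|/|z|\<close> and non-normality at escaping
  points\<close>

context singular_values_bound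
begin

text \<open>Let \<open>\<psi>\<close> be the logarithm of the branch of the inverse of
  \<open>f\<close> after \<open>exp\<close>. If its derivative were too large, Bloch's theorem with
  constant 1/12 would give a disc of radius more than \<open>pi\<close> in the image of
  \<open>\<psi>\<close>, hence a circle on which \<open>f\<close> exceeds \<open>R\<close> in
  modulus. The derivative of \<open>\<psi>\<close> at \<open>w\<close> is
  \<open>f z / (z * deriv f z)\<close>.\<close>

lemma logarithmic_expansion:
  assumes z: "R < norm (f z)"
  shows "(ln (norm (f z)) - ln R) * norm (f z) \<le> 12 * pi * norm z * norm (deriv f z)"
proof -
  define w where "w = Ln (f z)"
  \<comment> \<open>The distance from \<open>w\<close> to the boundary of the half-plane, thus the
    radius of the largest disc available to Bloch's theorem.\<close>
  define d where "d = Re w - ln R"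
  have nz: "f z \<noteq> 0" using z R by auto
  then have fz: "f z = exp w" by (simp add: w_def)
  have Rew: "Re w = ln (norm (f z))" using nz by (simp add: w_def)
  have wH: "ln R < Re w" using z R less_norm_exp_iff[OF R, of w] fz by simp
  then have d: "d > 0" by (simp add: d_def)
  obtain \<phi> where \<phi>: "\<phi> holomorphic_on {u. ln R < Re u}" "\<And>u. ln R < Re u \<Longrightarrow> f (\<phi> u) = exp u" "\<phi> w = z"
    using lift_exp_on_halfplane[OF holf crit asym R wH fz] by metis
  have sub: "ln R < Re u" if "u \<in> ball w d" for u
    using that abs_Re_le_cmod[of "w - u"] by (simp add: dist_norm d_def)
  have big: "R < norm (f (\<phi> u))" if "u \<in> ball w d" for u
    using \<phi>(2)[OF sub[OF that]] sub[OF that] less_norm_exp_iff[OF R, of u] by simp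
  have hol: "\<phi> holomorphic_on ball w d"
    using \<phi>(1) by (rule holomorphic_on_subset) (use sub in auto)
  have \<phi>nz: "\<phi> u \<noteq> 0" if "u \<in> ball w d" for u
    using big[OF that] f0 by auto
  obtain \<psi> where \<psi>: "\<psi> holomorphic_on ball w d" "\<And>u. u \<in> ball w d \<Longrightarrow> \<phi> u = exp (\<psi> u)"
    using contractible_imp_holomorphic_log[OF hol convex_imp_contractible[OF convex_ball] \<phi>nz] by metis
  have wB: "w \<in> ball w d" using d by simp
  have le: "d * norm (deriv \<psi> w) \<le> 12 * pi"
  proof (rule ccontr)
    assume "\<not> ?thesis"
    then have gt: "pi < d * norm (deriv \<psi> w) / 12" by simp
    obtain b where "ball b (d * norm (deriv \<psi> w) / 12) \<subseteq> \<psi> ` ball w d"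
      using Bloch[OF \<psi>(1) d order_refl] by metis
    from exp_image_contains_circle[OF this gt] obtain s where
      s: "s > 0" "sphere 0 s \<subseteq> exp ` \<psi> ` ball w d" by blast
    obtain u where u: "norm u = s" "norm (f u) \<le> R" using bounded_minimum_modulus[OF s(1)] by blast
    then have "u \<in> sphere 0 s" by simp
    then obtain v where "v \<in> ball w d" "u = exp (\<psi> v)" using s(2) by blast
    then have "u = \<phi> v" "v \<in> ball w d" using \<psi>(2) by auto
    then show False using big u by force
  qed
  have d\<psi>: "(\<psi> has_field_derivative deriv \<psi> w) (at w)"
    using \<psi>(1) wB holomorphic_derivI open_ball by blast
  have "((\<lambda>u. exp (\<psi> u)) has_field_derivative z * deriv \<psi> w) (at w)"
    using d\<psi> \<psi>(2)[OF wB] \<phi>(3) by (auto intro!: derivative_eq_intros)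
  then have d\<phi>: "(\<phi> has_field_derivative z * deriv \<psi> w) (at w)"
    by (rule has_field_derivative_transform_within_open[OF _ open_ball wB]) (use \<psi>(2) in simp)
  have df: "(f has_field_derivative deriv f z) (at (\<phi> w))"
    using holf \<phi>(3) by (auto intro: holomorphic_derivI)
  have "((\<lambda>u. f (\<phi> u)) has_field_derivative deriv f z * (z * deriv \<psi> w)) (at w)"
    using DERIV_chain2[OF df d\<phi>] by simp
  moreover have "((\<lambda>u. f (\<phi> u)) has_field_derivative exp w) (at w)"
    by (rule has_field_derivative_transform_within_open[OF DERIV_exp open_ball wB]) (use \<phi>(2) sub in simp)
  ultimately have "f z = deriv f z * (z * deriv \<psi> w)"
    unfolding fz by (rule DERIV_unique[symmetric])
  then have "norm (f z) = norm (deriv f z) * (norm z * norm (deriv \<psi> w))"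
    by (metis norm_mult)
  then have "d * norm (f z) = (d * norm (deriv \<psi> w)) * (norm z * norm (deriv f z))" by simp
  also have "\<dots> \<le> (12 * pi) * (norm z * norm (deriv f z))"
    using le by (intro mult_right_mono) auto
  finally show ?thesis by (simp add: d_def Rew mult.assoc)
qed

text \<open>If the late iterates of \<open>D\<close> avoided the disc of radius \<open>R\<close>,
  they would have logarithms on a disc around a late orbit point, with exponentially growing
  derivatives by the expansion estimate. Bloch's theorem then puts a circle into an iterate, and the
  next application of \<open>f\<close> returns below \<open>R\<close>.\<close>

lemma escaping_orbit_returns:
  assumes z0: "z0 \<in> escaping_set f" and D: "open D" "z0 \<in> D"
  shows "\<exists>n\<ge>N. \<exists>z\<in>D. norm ((f ^^ n) z) \<le> R"
proof (rule ccontr)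
  assume "\<not> ?thesis"
  then have out: "R < norm ((f ^^ n) z)" if "n \<ge> N" "z \<in> D" for n z using that by force
  \<comment> \<open>Above this threshold \<open>ln (norm (f u)) - ln R\<close> is at least
    \<open>24 * pi\<close>, twice the constant of the expansion estimate, so every step expands by a
    factor 2.\<close>
  have "\<forall>\<^sub>F n in sequentially. norm ((f ^^ n) z0) \<ge> R * exp (24 * pi)"
    using z0 R unfolding escaping_set_def by (auto simp: filterlim_at_infinity[OF order_refl])
  then obtain N1 where N1: "\<And>n. n \<ge> N1 \<Longrightarrow> norm ((f ^^ n) z0) \<ge> R * exp (24 * pi)"
    unfolding eventually_sequentially by blast
  define M where "M = max N N1"
  define w where "w = (f ^^ M) z0"
  have it: "(f ^^ n) ((f ^^ M) z) = (f ^^ (n + M)) z" for n z by (simp add: funpow_add)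
  have wbig: "norm ((f ^^ n) w) \<ge> R * exp (24 * pi)" for n
    unfolding w_def it by (rule N1) (simp add: M_def)
  obtain \<rho> where \<rho>: "\<rho> > 0" "ball w \<rho> \<subseteq> (f ^^ M) ` D"
    using open_funpow_image[OF te D(1), of M] D(2) unfolding open_contains_ball w_def by blast
  have out': "R < norm ((f ^^ n) u)" if u: "u \<in> ball w \<rho>" for u n
  proof -
    obtain z where "z \<in> D" "u = (f ^^ M) z" using u \<rho>(2) by blast
    then show ?thesis using out[of "n + M" z] it by (simp add: M_def)
  qed
  have wnz: "norm ((f ^^ n) w) > 0" for n using out'[of w n] \<rho>(1) R by auto
  have dfn: "((f ^^ n) has_field_derivative deriv (f ^^ n) u) (at u)" for n u
    using funpow_holomorphic_on_UNIV[OF holf, of n] by (auto intro: holomorphic_derivI)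
  have grow: "2 ^ n * norm ((f ^^ n) w) \<le> norm w * norm (deriv (f ^^ n) w)" for n
  proof (induction n)
    case 0
    show ?case by (simp add: id_def)
  next
    case (Suc n)
    define u where "u = (f ^^ n) w"
    have fu: "f u = (f ^^ Suc n) w" by (simp add: u_def)
    have un: "norm u > 0" using wnz[of n] by (simp add: u_def)
    have "ln (R * exp (24 * pi)) \<le> ln (norm (f u))"
      using wbig[of "Suc n"] R wnz[of "Suc n"] unfolding fu by (subst ln_le_cancel_iff) auto
    then have "24 * pi \<le> ln (norm (f u)) - ln R" using R by (simp add: ln_mult)
    then have "24 * pi * norm (f u) \<le> (ln (norm (f u)) - ln R) * norm (f u)"
      by (intro mult_right_mono) auto
    also have "\<dots> \<le> 12 * pi * norm u * norm (deriv f u)"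
      using out'[of w "Suc n"] \<rho>(1) by (intro logarithmic_expansion) (simp add: fu)
    finally have ex: "2 * norm (f u) \<le> norm u * norm (deriv f u)" by simp
    have "(f has_field_derivative deriv f u) (at ((f ^^ n) w))"
      using holf unfolding u_def by (auto intro: holomorphic_derivI)
    then have "((\<lambda>x. f ((f ^^ n) x)) has_field_derivative deriv f u * deriv (f ^^ n) w) (at w)"
      using DERIV_chain2 dfn by blast
    then have "deriv (f ^^ Suc n) w = deriv f u * deriv (f ^^ n) w"
      by (intro DERIV_imp_deriv) (simp add: o_def)
    then have "norm u * (norm w * norm (deriv (f ^^ Suc n) w)) = (norm u * norm (deriv f u)) * (norm w * norm (deriv (f ^^ n) w))"
      by (simp add: norm_mult)
    also have "\<dots> \<ge> (2 * norm (f u)) * (2 ^ n * norm u)"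
      using mult_mono[OF ex Suc[folded u_def]] by simp
    finally have "norm u * (2 ^ Suc n * norm (f u)) \<le> norm u * (norm w * norm (deriv (f ^^ Suc n) w))"
      by (simp add: mult_ac)
    then show ?case using un fu by (simp only: mult_le_cancel_left_pos)
  qed
  have w0: "norm w > 0" using wnz[of 0] by simp
  \<comment> \<open>So many steps make the Bloch disc of the logarithm of \<open>f ^^ n\<close> on
    \<open>ball w \<rho>\<close> larger than \<open>pi\<close> in radius.\<close>
  obtain n :: nat where n: "12 * pi * norm w / \<rho> < 2 ^ n"
    using real_arch_pow[of 2 "12 * pi * norm w / \<rho>"] by auto
  have holn: "(f ^^ n) holomorphic_on ball w \<rho>"
    using funpow_holomorphic_on_UNIV[OF holf] holomorphic_on_subset by blast
  have nzn: "(f ^^ n) u \<noteq> 0" if "u \<in> ball w \<rho>" for u using out'[OF that, of n] R by force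
  obtain L where L: "L holomorphic_on ball w \<rho>" "\<And>u. u \<in> ball w \<rho> \<Longrightarrow> (f ^^ n) u = exp (L u)"
    using contractible_imp_holomorphic_log[OF holn convex_imp_contractible[OF convex_ball] nzn] by metis
  have wB: "w \<in> ball w \<rho>" using \<rho> by simp
  have "(L has_field_derivative deriv L w) (at w)"
    using L(1) wB holomorphic_derivI open_ball by blast
  then have "((\<lambda>u. exp (L u)) has_field_derivative exp (L w) * deriv L w) (at w)"
    by (auto intro!: derivative_eq_intros)
  then have "((f ^^ n) has_field_derivative exp (L w) * deriv L w) (at w)"
    by (rule has_field_derivative_transform_within_open[OF _ open_ball wB]) (use L(2) in simp)
  then have "deriv (f ^^ n) w = (f ^^ n) w * deriv L w"
    using L(2)[OF wB] by (simp add: DERIV_imp_deriv)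
  then have "2 ^ n * norm ((f ^^ n) w) \<le> norm w * norm (deriv L w) * norm ((f ^^ n) w)"
    using grow[of n] by (simp add: norm_mult mult_ac)
  then have "2 ^ n \<le> norm w * norm (deriv L w)" using wnz[of n] by simp
  with n have "12 * pi * norm w / \<rho> < norm w * norm (deriv L w)" by linarith
  then have gt: "pi < \<rho> * norm (deriv L w) / 12" using w0 \<rho>(1) by (simp add: field_simps)
  obtain b where "ball b (\<rho> * norm (deriv L w) / 12) \<subseteq> L ` ball w \<rho>"
    using Bloch[OF L(1) \<rho>(1) order_refl] by metis
  from exp_image_contains_circle[OF this gt] obtain s where
    s: "s > 0" "sphere 0 s \<subseteq> exp ` L ` ball w \<rho>" by blast
  obtain u where u: "norm u = s" "norm (f u) \<le> R" using bounded_minimum_modulus[OF s(1)] by blast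
  then have "u \<in> sphere 0 s" by simp
  then obtain v where "v \<in> ball w \<rho>" "u = exp (L v)" using s(2) by blast
  then have "u = (f ^^ n) v" "v \<in> ball w \<rho>" using L(2) by auto
  then show False using out'[of v "Suc n"] u by simp
qed

text \<open>If \<open>a\<close> and \<open>b\<close> are both omitted, the normalised iterate
  \<open>F\<close> omits 0 and 1. At a nearby returning point it is bounded independently of
  \<open>n\<close>, so Schottky's theorem bounds it at \<open>z0\<close> as well, contrary to
  escape.\<close>

lemma escaping_orbit_hits_two_point_sets:
  assumes z0: "z0 \<in> escaping_set f" and D: "open D" "z0 \<in> D" and ab: "a \<noteq> b"
  shows "\<exists>n. \<exists>z\<in>D. (f ^^ n) z \<in> {a, b}"
proof (rule ccontr)
  assume "\<not> ?thesis"
  then have omit: "(f ^^ n) z \<noteq> a" "(f ^^ n) z \<noteq> b" if "z \<in> D" for n z using that by auto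
  obtain e where e: "e > 0" "cball z0 e \<subseteq> D" using D open_contains_cball by blast
  \<comment> \<open>A disc of radius \<open>2 * r\<close> centred within \<open>r\<close> of
    \<open>z0\<close> stays in \<open>D\<close> and contains \<open>z0\<close> within half its
    radius.\<close>
  define r where "r = e / 3"
  have r: "r > 0" using e by (simp add: r_def)
  define K where "K = (R + norm a) / norm (b - a)"
  \<comment> \<open>Schottky's bound on the disc of radius 1/2 for functions with
    \<open>norm (F 0) \<le> K\<close>.\<close>
  define C where "C = exp (pi * exp (pi * (2 + 2 * K + 12 * (1/2) / (1 - 1/2))))"
  have "\<forall>\<^sub>F n in sequentially. norm ((f ^^ n) z0) \<ge> \<bar>norm a + C * norm (b - a)\<bar> + 1"
    using z0 unfolding escaping_set_def by (auto simp: filterlim_at_infinity[OF order_refl])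
  then obtain N where N: "\<And>n. n \<ge> N \<Longrightarrow> norm ((f ^^ n) z0) \<ge> \<bar>norm a + C * norm (b - a)\<bar> + 1"
    unfolding eventually_sequentially by blast
  obtain n z where n: "n \<ge> N" and z: "z \<in> ball z0 r" "norm ((f ^^ n) z) \<le> R"
    using escaping_orbit_returns[OF z0 open_ball, of z0 r N] r by auto
  define F where "F u = ((f ^^ n) (z + of_real (2 * r) * u) - a) / (b - a)" for u
  have inD: "z + of_real (2 * r) * u \<in> D" if "u \<in> cball 0 1" for u
  proof -
    have "norm (of_real (2 * r) * u) \<le> 2 * r" using that r by (simp add: norm_mult)
    then have "dist z0 (z + of_real (2 * r) * u) \<le> e"
      using z(1) norm_triangle_ineq4[of "z0 - z" "of_real (2 * r) * u"] by (simp add: dist_norm r_def diff_diff_eq)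
    then show ?thesis using e by auto
  qed
  have "norm (F ((z0 - z) / of_real (2 * r))) \<le> C"
    unfolding C_def
  proof (rule Schottky[where f = F and t = "1/2"])
    have "(f ^^ n) \<circ> (\<lambda>u. z + of_real (2 * r) * u) holomorphic_on cball 0 1"
      using funpow_holomorphic_on_UNIV[OF holf]
      by (intro holomorphic_on_compose_gen[of _ _ _ UNIV]) (auto intro!: holomorphic_intros)
    then show "F holomorphic_on cball 0 1"
      unfolding F_def o_def using ab by (intro holomorphic_intros) auto
    have "norm ((f ^^ n) z - a) \<le> R + norm a" using z(2) norm_triangle_ineq4[of "(f ^^ n) z" a] by linarith
    then show "norm (F 0) \<le> K" using ab by (simp add: F_def K_def norm_divide divide_right_mono)
    show "\<not> (F u = 0 \<or> F u = 1)" if "u \<in> cball 0 1" for u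
      using omit[OF inD[OF that], of n] ab by (auto simp: F_def)
    show "norm ((z0 - z) / of_real (2 * r)) \<le> 1/2"
      using z(1) r by (simp add: norm_divide dist_norm field_simps)
  qed auto
  moreover have "F ((z0 - z) / of_real (2 * r)) = ((f ^^ n) z0 - a) / (b - a)"
    using r by (simp add: F_def)
  ultimately have "norm ((f ^^ n) z0 - a) / norm (b - a) \<le> C"
    by (simp only: norm_divide)
  then have "norm ((f ^^ n) z0 - a) \<le> C * norm (b - a)"
    using ab by (simp add: divide_le_eq)
  then have "norm ((f ^^ n) z0) \<le> norm a + C * norm (b - a)"
    using norm_triangle_ineq2[of "(f ^^ n) z0" a] by linarith
  with N[OF n] show False by linarith
qed

end

section \<open>Existence of escaping points\<close>

text \<open>A linear bound on arbitrarily large circles makes all Taylor coefficients of order at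
  least 2 vanish, by Cauchy's inequality, so \<open>f\<close> would be affine.\<close>

lemma transcendental_entire_growth:
  assumes te: "transcendental_entire f"
  shows "\<exists>s0. \<forall>s\<ge>s0. \<exists>z. norm z = s \<and> C * s < norm (f z)"
proof (rule ccontr)
  assume "\<not> ?thesis"
  then have small: "\<exists>s\<ge>s0. \<forall>z. norm z = s \<longrightarrow> norm (f z) \<le> C * s" for s0 by force
  have f: "f holomorphic_on UNIV" using te by (simp add: transcendental_entire_def)
  have zero: "(deriv ^^ n) f 0 = 0" if n: "n \<ge> 2" for n
  proof (rule ccontr)
    define a where "a = norm ((deriv ^^ n) f 0)"
    assume "(deriv ^^ n) f 0 \<noteq> 0"
    then have a: "a > 0" by (simp add: a_def)
    obtain s where s: "s \<ge> max 1 (fact n * \<bar>C\<bar> / a + 1)" "\<And>z. norm z = s \<Longrightarrow> norm (f z) \<le> C * s"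
      using small by blast
    then have s1: "s \<ge> 1" by simp
    have "a \<le> fact n * (\<bar>C\<bar> * s) / s ^ n"
      unfolding a_def
    proof (rule Cauchy_inequality)
      show "norm (f x) \<le> \<bar>C\<bar> * s" if "norm (0 - x) = s" for x
      proof -
        have "C * s \<le> \<bar>C\<bar> * s" using s1 by (intro mult_right_mono) auto
        moreover have "norm (f x) \<le> C * s" using s(2) that by simp
        ultimately show ?thesis by linarith
      qed
    qed (use f s1 in \<open>auto intro: holomorphic_on_subset holomorphic_on_imp_continuous_on\<close>)
    also have "\<dots> \<le> fact n * (\<bar>C\<bar> * s) / s ^ 2"
      using n s1 by (intro divide_left_mono power_increasing) auto
    also have "\<dots> = fact n * \<bar>C\<bar> / s" using s1 by (simp add: power2_eq_square)
    finally have "a * s \<le> fact n * \<bar>C\<bar>" using s1 by (simp add: field_simps)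
    then have "s \<le> fact n * \<bar>C\<bar> / a" using a by (simp add: field_simps)
    with s(1) show False by simp
  qed
  have "f w = poly [:f 0, deriv f 0:] w" for w
  proof -
    have "(\<lambda>n. (deriv ^^ n) f 0 / fact n * (w - 0) ^ n) sums f w"
      by (rule holomorphic_power_series[of _ _ "norm w + 1"]) (use f in \<open>auto intro: holomorphic_on_subset\<close>)
    moreover have "(\<lambda>n. (deriv ^^ n) f 0 / fact n * (w - 0) ^ n) sums (\<Sum>n<2. (deriv ^^ n) f 0 / fact n * (w - 0) ^ n)"
      by (rule sums_finite) (use zero in auto)
    ultimately have "f w = (\<Sum>n<2. (deriv ^^ n) f 0 / fact n * (w - 0) ^ n)"
      by (rule sums_unique2)
    then show ?thesis by (simp add: numeral_2_eq_2)
  qed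
  then show False using te unfolding transcendental_entire_def by blast
qed

text \<open>The factor \<open>exp 8\<close> is chosen so that \<open>exp\<close> maps a disc of radius 8 into the annulus, while the concentric
  disc of half that radius \<open>4 > \<pi>\<close> already covers the circle \<open>|z| = s\<close>.\<close>

definition annulus :: "real \<Rightarrow> complex set" where
  "annulus s = {z. s * exp (- 8) \<le> norm z \<and> norm z \<le> s * exp 8}"

lemma compact_annulus: "compact (annulus s)"
proof -
  have "annulus s = {z. s * exp (- 8) \<le> norm z} \<inter> cball 0 (s * exp 8)"
    by (auto simp: annulus_def)
  moreover have "closed {z::complex. s * exp (- 8) \<le> norm z}"
    by (intro closed_Collect_le continuous_intros)
  ultimately show ?thesis by (simp add: closed_Int_compact)
qed

text \<open>The points whose first \<open>n\<close> iterates follow the itinerary form a decreasing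
  sequence of compact sets. They are nonempty because any point of \<open>K n\<close> can be pulled
  back step by step through the coverings.\<close>

lemma orbit_through_compact_sets:
  fixes f :: "complex \<Rightarrow> complex"
  assumes contf: "continuous_on UNIV f"
    and comp_K: "\<And>n. compact (K n)"
    and cover: "\<And>n. K (Suc n) \<subseteq> f ` K n"
    and ne: "\<And>n. K n \<noteq> {}"
  shows "\<exists>z. \<forall>n. (f ^^ n) z \<in> K n"
proof -
  define F where "F n = {z. \<forall>k\<le>n. (f ^^ k) z \<in> K k}" for n
  have cl: "closed ((f ^^ k) -` K k)" for k
    using continuous_on_funpow[OF contf] compact_imp_closed[OF comp_K] by (intro closed_vimage) auto
  have comp: "compact (F n)" for n
  proof -
    have "F n = K 0 \<inter> (\<Inter>k\<in>{..n}. (f ^^ k) -` K k)"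
      by (auto simp: F_def)
    then show ?thesis using cl comp_K by (auto intro!: compact_Int_closed)
  qed
  have pull: "\<exists>z\<in>F n. (f ^^ n) z = w" if "w \<in> K n" for n w
    using that
  proof (induction n arbitrary: w)
    case 0
    then show ?case by (simp add: F_def)
  next
    case (Suc n)
    then obtain v where v: "v \<in> K n" "f v = w" using cover[of n] by blast
    with Suc.IH obtain z where z: "z \<in> F n" "(f ^^ n) z = v" by blast
    have "(f ^^ Suc n) z = w" using z v by simp
    moreover have "z \<in> F (Suc n)"
      using z(1) calculation Suc.prems by (auto simp: F_def le_Suc_eq)
    ultimately show ?case by blast
  qed
  have "\<Inter>(range F) \<noteq> {}"
  proof (rule compact_nest[OF comp])
    show "F n \<noteq> {}" for n using pull[of _ n] ne[of n] by blast
    show "F n \<subseteq> F m" if "m \<le> n" for m n using that by (auto simp: F_def)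
  qed
  then obtain z where "\<And>n. z \<in> F n" by blast
  then show ?thesis by (auto simp: F_def)
qed

section \<open>Covering of annuli and construction of an escaping orbit\<close>

context singular_values_bound
begin

text \<open>If the image omits a point from each of the two larger annuli, these points normalise
  \<open>f\<close> to a function omitting 0 and 1. It is bounded by 1 where the minimum modulus is
  small, so Schottky's theorem bounds it on the whole circle, contradicting growth faster than
  linear.\<close>

lemma annulus_covers_annulus:
  "\<exists>s0>0. \<forall>s\<ge>s0. annulus (exp 20 * s) \<subseteq> f ` annulus s \<or> annulus (exp 40 * s) \<subseteq> f ` annulus s"
proof -
  define K where "K = exp (pi * exp (pi * (2 + 2 * 1 + 12 * (1/2) / (1 - 1/2))))"
  \<comment> \<open>Chosen so that \<open>C * s\<close> dominates the final bound
    \<open>(1 + K) * (norm b + norm a)\<close>, as both omitted points have modulus at most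
    \<open>exp 48 * s\<close>.\<close>
  define C where "C = (1 + K) * (2 * exp 48)"
  obtain s0 where s0: "\<And>s. s \<ge> s0 \<Longrightarrow> \<exists>z. norm z = s \<and> C * s < norm (f z)"
    using transcendental_entire_growth[OF te, of C] by blast
  have "annulus (exp 20 * s) \<subseteq> f ` annulus s \<or> annulus (exp 40 * s) \<subseteq> f ` annulus s"
    if s: "s \<ge> max R s0" for s
  proof (rule ccontr)
    assume "\<not> ?thesis"
    then obtain a b where ab: "a \<in> annulus (exp 20 * s)" "a \<notin> f ` annulus s"
      "b \<in> annulus (exp 40 * s)" "b \<notin> f ` annulus s" by blast
    have sp: "s > 0" "R \<le> s" using s R by auto
    \<comment> \<open>The target annuli have radii between \<open>exp 12 * s\<close> and
      \<open>exp 28 * s\<close>, and between \<open>exp 32 * s\<close> and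
      \<open>exp 48 * s\<close>. The gap keeps \<open>a\<close> and \<open>b\<close> apart, with
      \<open>norm b\<close> at least three times \<open>norm a\<close>.\<close>
    have e12: "exp 20 * s * exp (-8) = exp 12 * s" "exp 20 * s * exp 8 = exp 28 * s"
      "exp 40 * s * exp (-8) = exp 32 * s" "exp 40 * s * exp 8 = exp 48 * s"
      by (simp_all add: exp_add[symmetric] mult_ac mult.assoc[symmetric])
    have na: "exp 12 * s \<le> norm a" "norm a \<le> exp 28 * s" and nb: "exp 32 * s \<le> norm b" "norm b \<le> exp 48 * s"
      using ab(1,3) unfolding annulus_def e12 by auto
    have "1 * s \<le> exp 12 * s" using sp by (intro mult_right_mono) auto
    then have Ra: "R \<le> norm a" using na sp by linarith
    have "exp 32 = exp 28 * exp (4::real)" by (simp add: exp_add[symmetric])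
    moreover have "exp (4::real) \<ge> 3" using exp_ge_add_one_self[of 4] by linarith
    ultimately have "exp (32::real) \<ge> 3 * exp 28" by simp
    then have "3 * exp 28 * s \<le> exp 32 * s" using sp by (intro mult_right_mono) auto
    then have ab3: "3 * norm a \<le> norm b" using na nb by linarith
    have bn: "norm (b - a) \<ge> norm b - norm a" "norm (b - a) \<le> norm b + norm a"
      using norm_triangle_ineq2[of b a] norm_triangle_ineq4[of b a] by auto
    have abne: "a \<noteq> b" using ab3 na sp Ra R by auto
    obtain z1 where z1: "norm z1 = s" "norm (f z1) \<le> R" using bounded_minimum_modulus[OF sp(1)] by blast
    obtain z2 where z2: "norm z2 = s" "C * s < norm (f z2)" using s0[of s] s by auto
    define q where "q = z2 / z1"
    have z1nz: "z1 \<noteq> 0" using z1 sp by auto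
    have nq: "norm q = 1" using z1 z2 sp by (simp add: q_def norm_divide)
    then have q0: "q \<noteq> 0" by auto
    have "norm (Ln q) \<le> pi" using nq by (rule norm_Ln_le_pi)
    then have nLq: "norm (Ln q / 8) \<le> 1/2" using pi_less_4 by (simp add: norm_divide)
    \<comment> \<open>The parameter 0 corresponds to \<open>z1\<close> and \<open>Ln q / 8\<close>,
      of modulus at most \<open>pi / 8 < 1/2\<close>, to \<open>z2\<close>.\<close>
    define F where "F u = (f (z1 * exp (8 * u)) - a) / (b - a)" for u
    have inA: "z1 * exp (8 * u) \<in> annulus s" if "u \<in> cball 0 1" for u
    proof -
      have "\<bar>Re u\<bar> \<le> 1" using that abs_Re_le_cmod[of u] by simp
      then have "exp (- 8) \<le> exp (8 * Re u)" "exp (8 * Re u) \<le> exp 8" by auto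
      then show ?thesis using sp by (simp add: annulus_def norm_mult z1)
    qed
    have "norm (F (Ln q / 8)) \<le> K"
      unfolding K_def
    proof (rule Schottky[where f = F and t = "1/2"])
      have "f \<circ> (\<lambda>u. z1 * exp (8 * u)) holomorphic_on cball 0 1"
        using holf by (intro holomorphic_on_compose_gen[of _ _ _ UNIV]) (auto intro!: holomorphic_intros)
      then show "F holomorphic_on cball 0 1"
        unfolding F_def o_def using abne by (intro holomorphic_intros) auto
      have "norm (f z1 - a) \<le> norm (b - a)"
        using z1(2) Ra ab3 bn norm_triangle_ineq4[of "f z1" a] by linarith
      then show "norm (F 0) \<le> 1" using abne by (simp add: F_def norm_divide)
      show "\<not> (F u = 0 \<or> F u = 1)" if "u \<in> cball 0 1" for u
        using inA[OF that] ab(2,4) abne by (auto simp: F_def)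
    qed (use nLq in auto)
    moreover have "F (Ln q / 8) = (f z2 - a) / (b - a)"
      using q0 z1nz by (simp add: F_def) (simp add: q_def)
    ultimately have "norm (f z2 - a) / norm (b - a) \<le> K" by (simp only: norm_divide)
    then have "norm (f z2 - a) \<le> K * norm (b - a)" using abne by (simp add: divide_le_eq)
    also have "\<dots> \<le> K * (norm b + norm a)" using bn by (intro mult_left_mono) (auto simp: K_def)
    finally have "norm (f z2) \<le> norm a + K * (norm b + norm a)"
      using norm_triangle_ineq2[of "f z2" a] by linarith
    also have "\<dots> \<le> (1 + K) * (norm b + norm a)" by (simp add: algebra_simps)
    also have "\<dots> \<le> (1 + K) * (2 * exp 48 * s)"
    proof (intro mult_left_mono)
      have "exp 28 * s \<le> exp 48 * s" using sp by (intro mult_right_mono) auto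
      then show "norm b + norm a \<le> 2 * exp 48 * s" using na nb by linarith
    qed (simp add: K_def)
    also have "\<dots> = C * s" by (simp add: C_def)
    finally show False using z2 by linarith
  qed
  moreover have "max R s0 > 0" using R by auto
  ultimately show ?thesis by blast
qed

text \<open>Iterating the covering, with whichever of the two factors works, gives annuli whose
  radii at least double at each step. A point whose orbit runs through them escapes.\<close>

lemma escaping_set_nonempty: "escaping_set f \<noteq> {}"
proof -
  obtain s0 where s0: "s0 > 0"
    "\<And>s. s \<ge> s0 \<Longrightarrow> annulus (exp 20 * s) \<subseteq> f ` annulus s \<or> annulus (exp 40 * s) \<subseteq> f ` annulus s"
    using annulus_covers_annulus by blast
  define s where "s = rec_nat s0 (\<lambda>_ t. if annulus (exp 20 * t) \<subseteq> f ` annulus t then exp 20 * t else exp 40 * t)"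
  have s_Suc: "s (Suc n) = (if annulus (exp 20 * s n) \<subseteq> f ` annulus (s n) then exp 20 * s n else exp 40 * s n)" for n
    by (simp add: s_def)
  have e2: "exp 20 \<ge> (2::real)" "exp 40 \<ge> (2::real)"
    using exp_ge_add_one_self[of "20::real"] exp_ge_add_one_self[of "40::real"] by linarith+
  have ge: "s0 * 2 ^ n \<le> s n" for n
  proof (induction n)
    case (Suc n)
    have "0 \<le> s0 * 2 ^ n" using s0(1) by simp
    then have "0 \<le> s n" using Suc by linarith
    then have "2 * s n \<le> s (Suc n)" unfolding s_Suc using e2 by (auto intro: mult_right_mono)
    then show ?case using Suc by simp
  qed (simp add: s_def)
  have ge0: "s0 \<le> s n" for n
  proof -
    have "s0 * 1 \<le> s0 * 2 ^ n" using s0(1) by (intro mult_left_mono) auto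
    then show ?thesis using ge[of n] by linarith
  qed
  have cover: "annulus (s (Suc n)) \<subseteq> f ` annulus (s n)" for n
    unfolding s_Suc using s0(2)[OF ge0[of n]] by auto
  have ne: "annulus (s n) \<noteq> {}" for n
  proof -
    have "s n > 0" using ge0[of n] s0(1) by linarith
    moreover have "exp (-8) \<le> (1::real)" "1 \<le> exp (8::real)" by auto
    ultimately have "of_real (s n) \<in> annulus (s n)"
      by (simp add: annulus_def)
    then show ?thesis by blast
  qed
  obtain z where z: "\<And>n. (f ^^ n) z \<in> annulus (s n)"
    using orbit_through_compact_sets[of f "\<lambda>n. annulus (s n)"] holomorphic_on_imp_continuous_on[OF holf] compact_annulus cover ne
    by blast
  have "filterlim (\<lambda>n. (f ^^ n) z) at_infinity sequentially"
    unfolding filterlim_at_infinity[OF order_refl]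
  proof (intro allI impI)
    fix B :: real
    obtain N where N: "B / (s0 * exp (- 8)) < 2 ^ N"
      using real_arch_pow[of 2] by auto
    show "\<forall>\<^sub>F n in sequentially. B \<le> norm ((f ^^ n) z)"
      using eventually_ge_at_top[of N]
    proof eventually_elim
      case (elim n)
      have "B < 2 ^ N * (s0 * exp (- 8))" using N s0(1) by (simp add: field_simps)
      also have "\<dots> \<le> 2 ^ n * (s0 * exp (- 8))"
        using elim s0(1) by (intro mult_right_mono power_increasing) auto
      also have "\<dots> = (s0 * 2 ^ n) * exp (- 8)" by simp
      also have "\<dots> \<le> s n * exp (- 8)" using ge[of n] by (intro mult_right_mono) auto
      also have "\<dots> \<le> norm ((f ^^ n) z)" using z[of n] by (simp add: annulus_def)
      finally show ?case by simp
    qed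
  qed
  then show ?thesis by (auto simp: escaping_set_def)
qed

end

section \<open>Compositions and commuting functions\<close>

lemma bounded_typeE:
  assumes te: "transcendental_entire f" and bt: "bounded_type f"
  obtains R where "singular_values_bound f R"
proof -
  have "bounded (critical_values f \<union> asymptotic_values f)"
    using bt closure_subset bounded_subset unfolding bounded_type_def by blast
  then obtain B where "\<And>z. z \<in> critical_values f \<union> asymptotic_values f \<Longrightarrow> norm z \<le> B"
    unfolding bounded_iff by blast
  \<comment> \<open>The 1 makes the bound positive, and \<open>norm (f 0)\<close> meets the
    condition at the origin.\<close>
  then have "singular_values_bound f (max 1 (max B (norm (f 0))))"
    using te by unfold_locales (auto simp: le_max_iff_disj)
  then show ?thesis by (rule that)
qed

lemma transcendental_entire_compose:
  assumes f: "transcendental_entire f" and g: "transcendental_entire g"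
  shows "transcendental_entire (f \<circ> g)"
proof -
  have holf: "f holomorphic_on UNIV" and holg: "g holomorphic_on UNIV"
    using f g by (auto simp: transcendental_entire_def)
  then have cont: "continuous_on UNIV f" "continuous_on UNIV g"
    by (auto intro: holomorphic_on_imp_continuous_on)
  have hol: "f \<circ> g holomorphic_on UNIV"
    using holomorphic_on_compose_gen[OF holg holf] by simp
  \<comment> \<open>If \<open>f\<close> is constant on the open set \<open>range g\<close>, it is
    constant by the identity theorem.\<close>
  have nonconst: "\<not> (f \<circ> g) constant_on UNIV"
  proof
    assume "(f \<circ> g) constant_on UNIV"
    then obtain c where c: "\<And>z. f (g z) = c" unfolding constant_on_def by auto
    have "open (range g)"
      using open_funpow_image[OF g open_UNIV, of 1] by simp
    moreover have "g 0 \<in> range g" by simp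
    ultimately have "f w = c" for w
      using analytic_continuation_open[of "range g" UNIV f "\<lambda>_. c" w] holf c by auto
    then show False using transcendental_entire_not_constant[OF f] unfolding constant_on_def by blast
  qed
  have "\<not> (\<exists>p. \<forall>z. (f \<circ> g) z = poly p z)"
  proof
    assume "\<exists>p. \<forall>z. (f \<circ> g) z = poly p z"
    then obtain p where p: "\<And>z. f (g z) = poly p z" by auto
    have fg: "f \<circ> g = (\<lambda>z. \<Sum>i\<le>degree p. coeff p i * z ^ i)"
      using p by (auto simp: poly_altdef)
    have "degree p \<noteq> 0"
    proof
      assume "degree p = 0"
      then obtain c where "p = [:c:]" by (rule degree_eq_zeroE)
      then show False using nonconst p unfolding constant_on_def by auto
    qed
    then have "0 < degree p \<and> coeff p (degree p) \<noteq> 0 \<and> f \<circ> g = (\<lambda>z. \<Sum>i\<le>degree p. coeff p i * z ^ i)"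
      using fg by auto
    then have proper: "compact {z. (f \<circ> g) z \<in> K}" if "compact K" for K
      using proper_map_polyfun_eq[OF hol] that by blast
    have "compact {z. g z \<in> K}" if K: "compact K" for K
    proof -
      have "compact (f ` K)"
        using K cont(1) compact_continuous_image continuous_on_subset by blast
      then have "compact {z. (f \<circ> g) z \<in> f ` K}" by (rule proper)
      moreover have "closed {z. g z \<in> K}"
        using closed_vimage[OF compact_imp_closed[OF K] cont(2)] by (simp add: vimage_def)
      moreover have "{z. g z \<in> K} = {z. (f \<circ> g) z \<in> f ` K} \<inter> {z. g z \<in> K}" by auto
      ultimately show ?thesis by (metis compact_Int_closed)
    qed
    then show False using transcendental_entire_not_proper[OF g] by blast
  qed
  with hol show ?thesis by (simp add: transcendental_entire_def)
qed

section \<open>Singular values of a composition\<close>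

lemma critical_values_compose:
  assumes f: "f holomorphic_on UNIV" and g: "g holomorphic_on UNIV"
  shows "critical_values (f \<circ> g) \<subseteq> critical_values f \<union> f ` critical_values g"
proof
  fix w assume "w \<in> critical_values (f \<circ> g)"
  then obtain z where z: "w = f (g z)" "deriv (f \<circ> g) z = 0" by (auto simp: critical_values_def)
  have "deriv (f \<circ> g) z = deriv f (g z) * deriv g z"
    using f g by (intro deriv_chain) (auto simp: holomorphic_on_def)
  then show "w \<in> critical_values f \<union> f ` critical_values g"
    using z by (auto simp: critical_values_def)
qed

text \<open>The level sets of \<open>f\<close> are discrete, so a path along which \<open>f\<close> converges cannot oscillate: it tends to
  each of its finite accumulation points.\<close>

lemma path_tendsto_accumulation_point:
  fixes p :: "real \<Rightarrow> complex"
  assumes f: "f holomorphic_on UNIV" and nc: "\<not> f constant_on UNIV"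
    and p: "continuous_on {0..<1} p"
    and lim: "((\<lambda>t. f (p t)) \<longlongrightarrow> a) (at_left 1)"
    and z: "\<And>\<epsilon>. \<epsilon> > 0 \<Longrightarrow> \<exists>\<^sub>F t in at_left 1. p t \<in> ball z \<epsilon>"
  shows "(p \<longlongrightarrow> z) (at_left 1)"
proof (rule tendstoI)
  fix e :: real assume e: "e > 0"
  have fz: "f z = a" by (rule accumulation_value[OF z f lim])
  obtain b where b: "f b \<noteq> a" using nc unfolding constant_on_def by blast
  have "(\<lambda>u. f u - a) holomorphic_on UNIV" using f by (intro holomorphic_intros)
  then obtain r where r: "r > 0" "\<And>u. u \<in> ball z r - {z} \<Longrightarrow> f u - a \<noteq> 0"
    using isolated_zeros[of "\<lambda>u. f u - a" UNIV z b] fz b by auto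
  define d where "d = min e r / 2"
  have d: "d > 0" "d < e" "d < r" using e r by (auto simp: d_def)
  have "continuous_on (sphere z d) (\<lambda>u. norm (f u - a))"
    by (intro continuous_intros continuous_on_subset[OF holomorphic_on_imp_continuous_on[OF f]]) auto
  moreover have "sphere z d \<noteq> {}" using d by simp
  ultimately obtain u0 where u0: "u0 \<in> sphere z d" "\<And>u. u \<in> sphere z d \<Longrightarrow> norm (f u0 - a) \<le> norm (f u - a)"
    using continuous_attains_inf[OF compact_sphere] by blast
  \<comment> \<open>On the circle of radius \<open>d\<close> around \<open>z\<close>,
    \<open>f\<close> stays at least \<open>m\<close> away from \<open>a\<close>. Once
    \<open>f\<close> is closer than that along the path, the path can no longer cross the
    circle.\<close>
  define m where "m = norm (f u0 - a)"
  have "u0 \<in> ball z r - {z}" using u0(1) d by auto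
  then have m: "m > 0" using r(2) unfolding m_def by simp
  have "\<forall>\<^sub>F t in at_left 1. dist (f (p t)) a < m" using lim m by (rule tendstoD)
  then obtain t0 where t0: "t0 < 1" "\<And>t. t0 < t \<Longrightarrow> t < 1 \<Longrightarrow> dist (f (p t)) a < m"
    unfolding eventually_at_left_field by blast
  define I where "I = {max 0 t0<..<1}"
  have evI: "\<forall>\<^sub>F t in at_left 1. t \<in> I"
    unfolding I_def using t0(1) by (intro eventually_at_left_real) auto
  have "\<exists>\<^sub>F t in at_left 1. p t \<in> ball z d \<and> t \<in> I"
    by (rule frequently_eventually_frequently[OF z[OF d(1)] evI])
  then obtain t1 where t1: "p t1 \<in> ball z d" "t1 \<in> I" by (auto dest!: frequently_ex)
  have "connected (p ` I)"
    by (rule connected_continuous_image[OF continuous_on_subset[OF p]]) (auto simp: I_def)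
  moreover have "p ` I \<inter> frontier (ball z d) = {}"
  proof -
    have "p t \<notin> sphere z d" if "t \<in> I" for t
      using u0(2)[of "p t"] t0(2)[of t] that by (auto simp: m_def I_def dist_norm)
    then show ?thesis using d by auto
  qed
  ultimately have "p ` I - ball z d = {}"
    using connected_Int_frontier[of "p ` I" "ball z d"] t1 by blast
  then have "p t \<in> ball z d" if "t \<in> I" for t using that by blast
  with evI have "\<forall>\<^sub>F t in at_left 1. p t \<in> ball z d" by (auto elim: eventually_mono)
  then show "\<forall>\<^sub>F t in at_left 1. dist (p t) z < e"
    by (rule eventually_mono) (use d in \<open>auto simp: dist_commute\<close>)
qed

text \<open>Along an asymptotic path of \<open>f \<circ> g\<close>, the image under \<open>g\<close>
  either tends to infinity, and is an asymptotic path of \<open>f\<close>, or converges to a finite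
  point, which is then an asymptotic value of \<open>g\<close>.\<close>

lemma asymptotic_values_compose:
  assumes f: "f holomorphic_on UNIV" and nc: "\<not> f constant_on UNIV" and g: "g holomorphic_on UNIV"
  shows "asymptotic_values (f \<circ> g) \<subseteq> asymptotic_values f \<union> f ` asymptotic_values g"
proof
  fix a assume "a \<in> asymptotic_values (f \<circ> g)"
  then obtain \<gamma> where \<gamma>: "continuous_on {0..<1} \<gamma>" "filterlim \<gamma> at_infinity (at_left 1)"
    "((\<lambda>t. f (g (\<gamma> t))) \<longlongrightarrow> a) (at_left (1::real))"
    by (auto simp: asymptotic_values_def)
  have cont: "continuous_on {0..<1} (\<lambda>t. g (\<gamma> t))"
    by (rule continuous_on_compose2[OF holomorphic_on_imp_continuous_on[OF g] \<gamma>(1)]) auto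
  show "a \<in> asymptotic_values f \<union> f ` asymptotic_values g"
  proof (cases "filterlim (\<lambda>t. g (\<gamma> t)) at_infinity (at_left 1)")
    case True
    then show ?thesis using cont \<gamma>(3) unfolding asymptotic_values_def by blast
  next
    case False
    then obtain z where z: "\<And>\<epsilon>. \<epsilon> > 0 \<Longrightarrow> \<exists>\<^sub>F t in at_left 1. g (\<gamma> t) \<in> ball z \<epsilon>"
      using accumulation_point_of_path by blast
    have "((\<lambda>t. g (\<gamma> t)) \<longlongrightarrow> z) (at_left 1)"
      by (rule path_tendsto_accumulation_point[OF f nc cont \<gamma>(3) z])
    then have "z \<in> asymptotic_values g" using \<gamma> unfolding asymptotic_values_def by blast
    moreover have "f z = a" by (rule accumulation_value[OF z f \<gamma>(3)])
    ultimately show ?thesis by blast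
  qed
qed

lemma bounded_type_compose:
  assumes f: "transcendental_entire f" "bounded_type f" and g: "g holomorphic_on UNIV" "bounded_type g"
  shows "bounded_type (f \<circ> g)"
proof -
  define S where "S h = closure (critical_values h \<union> asymptotic_values h)" for h
  have holf: "f holomorphic_on UNIV" using f by (simp add: transcendental_entire_def)
  have bd: "bounded (S f)" "bounded (S g)" using f g by (auto simp: bounded_type_def S_def)
  have "compact (S g)" using bd(2) unfolding S_def compact_eq_bounded_closed by blast
  then have "compact (f ` S g)"
    using holf holomorphic_on_imp_continuous_on continuous_on_subset compact_continuous_image by blast
  then have "bounded (S f \<union> f ` S g)" using bd by (simp add: compact_imp_bounded)
  moreover have "critical_values (f \<circ> g) \<union> asymptotic_values (f \<circ> g) \<subseteq> S f \<union> f ` S g"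
    using critical_values_compose[OF holf g(1)]
      asymptotic_values_compose[OF holf transcendental_entire_not_constant[OF f(1)] g(1)]
      closure_subset[of "critical_values f \<union> asymptotic_values f"]
      closure_subset[of "critical_values g \<union> asymptotic_values g"]
    unfolding S_def by blast
  ultimately show ?thesis
    unfolding bounded_type_def using bounded_subset bounded_closure by blast
qed

section \<open>Escaping sets of commuting functions and of iterates\<close>

lemma filterlim_at_infinity_if_continuous_image:
  fixes k :: "complex \<Rightarrow> complex"
  assumes k: "continuous_on UNIV k" and lim: "filterlim (\<lambda>n. k (x n)) at_infinity F"
  shows "filterlim x at_infinity F"
  unfolding filterlim_at_infinity[OF order_refl]
proof (intro allI impI)
  fix B :: real assume "B > 0"
  have "bounded (k ` cball 0 B)"
    using k by (intro compact_imp_bounded compact_continuous_image) (auto intro: continuous_on_subset)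
  then obtain C where C: "C > 0" "\<And>z. norm z \<le> B \<Longrightarrow> norm (k z) \<le> C"
    unfolding bounded_pos by auto
  have "\<forall>\<^sub>F n in F. C + 1 \<le> norm (k (x n))"
    using lim C(1) unfolding filterlim_at_infinity[OF order_refl] by auto
  then show "\<forall>\<^sub>F n in F. B \<le> norm (x n)"
  proof eventually_elim
    case (elim n)
    then show ?case using C(2)[of "x n"] by linarith
  qed
qed

text \<open>The image under \<open>k\<close> of the \<open>h\<close>-orbit of \<open>z\<close> is
  the \<open>h\<close>-orbit of \<open>k z\<close>. Since \<open>k\<close> is bounded on discs, the
  former orbit tends to infinity if the latter does.\<close>

lemma escaping_set_backward_invariant:
  assumes k: "continuous_on UNIV k" and comm: "\<And>z. k (h z) = h (k z)"
    and z: "k z \<in> escaping_set h"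
  shows "z \<in> escaping_set h"
proof -
  have "k ((h ^^ n) z) = (h ^^ n) (k z)" for n by (induction n) (simp_all add: comm)
  then have "filterlim (\<lambda>n. k ((h ^^ n) z)) at_infinity sequentially"
    using z by (simp add: escaping_set_def)
  then show ?thesis
    unfolding escaping_set_def using filterlim_at_infinity_if_continuous_image[OF k] by simp
qed

lemma escaping_set_forward_invariant:
  assumes "z \<in> escaping_set h"
  shows "h z \<in> escaping_set h"
proof -
  have "filterlim (\<lambda>n. (h ^^ (n + 1)) z) at_infinity sequentially"
    using assms filterlim_compose[OF _ filterlim_add_const_nat_at_top[of 1]] unfolding escaping_set_def by blast
  then show ?thesis by (simp add: escaping_set_def funpow_swap1)
qed

text \<open>Serves to produce two distinct points of the escaping set, namely an escaping point and
  its image.\<close>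

lemma escaping_set_no_fixed_point:
  assumes "z \<in> escaping_set h"
  shows "h z \<noteq> z"
proof
  assume "h z = z"
  then have "(h ^^ n) z = z" for n by (induction n) auto
  then have "filterlim (\<lambda>n::nat. z) at_infinity sequentially"
    using assms by (simp add: escaping_set_def)
  moreover have "((\<lambda>n::nat. z) \<longlongrightarrow> z) sequentially" by simp
  ultimately show False
    using not_tendsto_and_filterlim_at_infinity[of sequentially "\<lambda>n. z" z] by simp
qed

text \<open>Near an escaping point of \<open>f\<close> some iterate of \<open>f\<close> takes one of
  the values \<open>a\<close> and \<open>h a\<close>, both escaping under \<open>h\<close>. That
  iterate commutes with \<open>h\<close>, so the point where the value is taken escapes under
  \<open>h\<close> as well.\<close>

lemma (in singular_values_bound) escaping_set_subset_closure:
  assumes comm: "\<And>z. f (h z) = h (f z)" and ne: "escaping_set h \<noteq> {}"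
  shows "escaping_set f \<subseteq> closure (escaping_set h)"
proof
  fix z0 assume z0: "z0 \<in> escaping_set f"
  obtain a where a: "a \<in> escaping_set h" using ne by blast
  have ha: "h a \<in> escaping_set h" "a \<noteq> h a"
    using a escaping_set_forward_invariant escaping_set_no_fixed_point[OF a] by auto
  have "\<exists>z\<in>escaping_set h. z \<in> D" if D: "open D" "z0 \<in> D" for D
  proof -
    obtain n z where z: "z \<in> D" "(f ^^ n) z \<in> {a, h a}"
      using escaping_orbit_hits_two_point_sets[OF z0 D ha(2)] by blast
    have "(f ^^ n) (h u) = h ((f ^^ n) u)" for u by (induction n) (simp_all add: comm)
    then have "z \<in> escaping_set h"
      using escaping_set_backward_invariant[of "f ^^ n" h z] z(2) a ha
        holomorphic_on_imp_continuous_on[OF funpow_holomorphic_on_UNIV[OF holf]] by auto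
    with z show ?thesis by blast
  qed
  then show "z0 \<in> closure (escaping_set h)"
    unfolding closure_iff_nhds_not_empty by (metis disjoint_iff subset_eq)
qed

text \<open>From time \<open>n\<close> the next multiple of \<open>k\<close> is at most
  \<open>k\<close> steps away, and the iterates of order at most \<open>k\<close> are uniformly
  bounded on each disc. Escape along the multiples thus forces escape of the whole orbit.\<close>

lemma escaping_set_funpow:
  assumes f: "continuous_on UNIV f" and k: "k > 0"
  shows "escaping_set (f ^^ k) = escaping_set f"
proof (intro equalityI subsetI)
  fix z assume "z \<in> escaping_set f"
  moreover have "filterlim (\<lambda>n. k * n) sequentially sequentially"
    using k by (intro filterlim_subseq) (auto simp: strict_mono_def)
  ultimately have "filterlim (\<lambda>n. (f ^^ (k * n)) z) at_infinity sequentially"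
    using filterlim_compose unfolding escaping_set_def by blast
  then show "z \<in> escaping_set (f ^^ k)" by (simp add: escaping_set_def funpow_mult)
next
  fix z assume z: "z \<in> escaping_set (f ^^ k)"
  have lim: "filterlim (\<lambda>n. (f ^^ (k * n)) z) at_infinity sequentially"
    using z by (simp add: escaping_set_def funpow_mult)
  have "filterlim (\<lambda>n. (f ^^ n) z) at_infinity sequentially"
    unfolding filterlim_at_infinity[OF order_refl]
  proof (intro allI impI)
    fix B :: real assume "B > 0"
    have "bounded (\<Union>j\<le>k. (f ^^ j) ` cball 0 B)"
      using continuous_on_funpow[OF f] by (intro bounded_UN ballI compact_imp_bounded compact_continuous_image)
        (auto intro: continuous_on_subset)
    then obtain C where C: "C > 0" "\<And>j u. j \<le> k \<Longrightarrow> norm u \<le> B \<Longrightarrow> norm ((f ^^ j) u) \<le> C"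
      unfolding bounded_pos by auto
    have "\<forall>\<^sub>F n in sequentially. C + 1 \<le> norm ((f ^^ (k * n)) z)"
      using lim C(1) unfolding filterlim_at_infinity[OF order_refl] by auto
    then obtain N where N: "\<And>n. n \<ge> N \<Longrightarrow> C + 1 \<le> norm ((f ^^ (k * n)) z)"
      unfolding eventually_sequentially by blast
    show "\<forall>\<^sub>F n in sequentially. B \<le> norm ((f ^^ n) z)"
      using eventually_ge_at_top[of "k * N"]
    proof eventually_elim
      case (elim n)
      \<comment> \<open>The distance from \<open>n\<close> to \<open>k * Suc (n div k)\<close>; it
        equals \<open>k\<close>, not 0, when \<open>k\<close> divides \<open>n\<close>.\<close>
      define j where "j = k - n mod k"
      have "n mod k < k" using k by simp
      moreover have "k * Suc (n div k) + n mod k = k + n"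
        using mult_div_mod_eq[of k n] by (simp only: mult_Suc_right)
      ultimately have "k * Suc (n div k) = j + n" unfolding j_def by linarith
      then have "(f ^^ (k * Suc (n div k))) z = (f ^^ j) ((f ^^ n) z)"
        by (simp add: funpow_add)
      moreover have "N \<le> Suc (n div k)"
        using elim k by (simp add: div_le_mono le_SucI less_eq_div_iff_mult_less_eq mult.commute)
      ultimately have "C + 1 \<le> norm ((f ^^ j) ((f ^^ n) z))" using N by metis
      moreover have "j \<le> k" by (simp add: j_def)
      ultimately show ?case using C(2)[of j "(f ^^ n) z"] by force
    qed
  qed
  then show "z \<in> escaping_set f" by (simp add: escaping_set_def)
qed

theorem theorem9:
  fixes f g :: "complex \<Rightarrow> complex"
  assumes "transcendental_entire f" and "transcendental_entire g"
  shows "((f \<circ> g = g \<circ> f \<and> bounded_type f \<and> bounded_type g) \<longrightarrow>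
            closure (escaping_set f) = closure (escaping_set (f \<circ> g)))
       \<and> (\<forall>c m. c \<noteq> 0 \<and> (\<forall>z. f (z + c) = f z) \<and> (\<forall>z. g z = (f ^^ m) z + c) \<longrightarrow>
            closure (escaping_set f) = closure (escaping_set (f \<circ> g)))"
proof (intro conjI impI allI)
  assume *: "f \<circ> g = g \<circ> f \<and> bounded_type f \<and> bounded_type g"
  have holg: "g holomorphic_on UNIV" using assms(2) by (simp add: transcendental_entire_def)
  obtain R where "singular_values_bound f R" using bounded_typeE assms(1) * by blast
  then interpret f: singular_values_bound f R .
  obtain R' where "singular_values_bound (f \<circ> g) R'"
    using bounded_typeE transcendental_entire_compose[OF assms] bounded_type_compose[OF assms(1) _ holg] * by blast
  then interpret h: singular_values_bound "f \<circ> g" R' .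
  have "f (g z) = g (f z)" for z using * by (metis comp_apply)
  then have comm: "f ((f \<circ> g) z) = (f \<circ> g) (f z)" for z by simp
  have "escaping_set f \<subseteq> closure (escaping_set (f \<circ> g))"
    by (rule f.escaping_set_subset_closure[OF comm h.escaping_set_nonempty])
  moreover have "escaping_set (f \<circ> g) \<subseteq> closure (escaping_set f)"
    \<comment> \<open>The roles of \<open>f\<close> and \<open>f \<circ> g\<close> are
      interchangeable, since they commute and both have bounded singular values.\<close>
    by (rule h.escaping_set_subset_closure[OF comm[symmetric] f.escaping_set_nonempty])
  ultimately show "closure (escaping_set f) = closure (escaping_set (f \<circ> g))"
    by (simp add: closure_minimal subset_antisym)
next
  fix c m
  assume *: "c \<noteq> 0 \<and> (\<forall>z. f (z + c) = f z) \<and> (\<forall>z. g z = (f ^^ m) z + c)"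
  \<comment> \<open>Periodicity lets the outer \<open>f\<close> absorb the translation by
    \<open>c\<close>.\<close>
  have "f \<circ> g = f ^^ Suc m" using * by (simp add: fun_eq_iff)
  moreover have "continuous_on UNIV f"
    using assms(1) by (auto simp: transcendental_entire_def intro: holomorphic_on_imp_continuous_on)
  ultimately show "closure (escaping_set f) = closure (escaping_set (f \<circ> g))"
    by (simp only: escaping_set_funpow zero_less_Suc)
qed

end
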